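(* Let $A,B,C,D$ be complex constants with $C\ne0$, and let $\psi(z)=Ce^{Dz}$, $\varphi(z)=Az+B$, $\widehat\psi(z)=\overline Ce^{\overline Bz}$, $\widehat\varphi(z)=\overline Az+\overline D$. Then $$W_{\psi,\varphi,\max}^*=W_{\widehat\psi,\widehat\varphi,\max}$$ as operators on $\mathcal F^2$ (equality including equality of domains).
   Context: The Fock space $\mathcal F^2$ is the Hilbert space of entire functions on $\mathbb C$ that are square integrable with respect to $\frac1\pi e^{-|z|^2}\,dV(z)$ ($dV$ is Lebesgue measure on $\mathbb C$), with inner product $\langle f,g\rangle=\frac1\pi\int_{\mathbb C}f(z)\overline{g(z)}e^{-|z|^2}\,dV(z)$. For entire functions $\psi,\varphi$, put $E(\psi,\varphi)f=\psi\cdot (f\circ\varphi)$. The maximal weighted composition operator $W_{\psi,\varphi,\max}$ has domain $\{f\in\mathcal F^2: E(\psi,\varphi)f\in\mathcal F^2\}$ and acts by $W_{\psi,\varphi,\max}f=E(\psi,\varphi)f$. The star denotes the Hilbert space adjoint of a densely defined operator. *)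

theory Defs
  imports "HOL-Complex_Analysis.Complex_Analysis"
begin

definition fock_space :: "(complex \<Rightarrow> complex) set" where
  "fock_space = {f. f holomorphic_on UNIV \<and>
     integrable lborel (\<lambda>z. (cmod (f z))\<^sup>2 * exp (- (cmod z)\<^sup>2))}"

definition fock_inner :: "(complex \<Rightarrow> complex) \<Rightarrow> (complex \<Rightarrow> complex) \<Rightarrow> complex" where
  "fock_inner f g =
     1 / of_real pi * (LINT z|lborel. f z * cnj (g z) * of_real (exp (- (cmod z)\<^sup>2)))"

definition fock_norm :: "(complex \<Rightarrow> complex) \<Rightarrow> real" where
  "fock_norm f = sqrt (Re (fock_inner f f))"

text \<open>An (in general unbounded) operator on the Fock space is a partial map, defined exactly
  on its domain; equality of two such maps therefore includes equality of the domains.\<close>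

type_synonym fock_operator = "(complex \<Rightarrow> complex) \<rightharpoonup> (complex \<Rightarrow> complex)"

definition densely_defined :: "fock_operator \<Rightarrow> bool" where
  "densely_defined T \<longleftrightarrow> dom T \<subseteq> fock_space \<and>
     (\<forall>f\<in>fock_space. \<forall>\<epsilon>>0. \<exists>g\<in>dom T. fock_norm (\<lambda>z. f z - g z) < \<epsilon>)"

definition adjoint_pair :: "fock_operator \<Rightarrow> (complex \<Rightarrow> complex) \<Rightarrow> (complex \<Rightarrow> complex) \<Rightarrow> bool" where
  "adjoint_pair T g h \<longleftrightarrow> g \<in> fock_space \<and> h \<in> fock_space \<and>
     (\<forall>f\<in>dom T. fock_inner (the (T f)) g = fock_inner f h)"

text \<open>The vector \<open>h\<close> below is unique, and the adjoint thus meaningful, only when \<open>T\<close> is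
  densely defined.\<close>

definition fock_adjoint :: "fock_operator \<Rightarrow> fock_operator" where
  "fock_adjoint T = (\<lambda>g. if \<exists>h. adjoint_pair T g h then Some (THE h. adjoint_pair T g h) else None)"

definition weighted_comp ::
  "(complex \<Rightarrow> complex) \<Rightarrow> (complex \<Rightarrow> complex) \<Rightarrow> (complex \<Rightarrow> complex) \<Rightarrow> (complex \<Rightarrow> complex)" where
  "weighted_comp \<psi> \<phi> f = (\<lambda>z. \<psi> z * f (\<phi> z))"

definition weighted_comp_max ::
  "(complex \<Rightarrow> complex) \<Rightarrow> (complex \<Rightarrow> complex) \<Rightarrow> fock_operator" where
  "weighted_comp_max \<psi> \<phi> = (\<lambda>f. if f \<in> fock_space \<and> weighted_comp \<psi> \<phi> f \<in> fock_space
     then Some (weighted_comp \<psi> \<phi> f) else None)"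

end

theory Submission
  imports Defs "HOL-Probability.Distributions"
begin

text \<open>
  Testing the adjoint against the kernels \<open>exp (cnj w * z)\<close> shows that it is a restriction of the
  maximal operator with the hatted symbols. The substance is the converse,
  \<open>\<langle>W f, g\<rangle> = \<langle>f, W' g\<rangle>\<close> as soon as both sides make sense. For \<open>\<bar>A\<bar> < 1\<close>, insert the reproducing
  formula for \<open>f\<close> and exchange the integrals, which converge absolutely because
  \<open>2 \<bar>A z w\<bar> \<le> \<bar>A\<bar> (\<bar>z\<bar>\<^sup>2 + \<bar>w\<bar>\<^sup>2)\<close>. For \<open>\<bar>A\<bar> = 1\<close>, apply this to \<open>z \<mapsto> (W f) (r z)\<close>, which is a weighted
  composition with \<open>\<bar>r A\<bar> < 1\<close>, and let \<open>r\<close> tend to \<open>1\<close>; both sides converge weakly since the dilated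
  functions stay bounded in norm. For \<open>\<bar>A\<bar> > 1\<close>, apply the first case to the inverse operators.

  The domain is dense because it contains the polynomials: these approximate \<open>z \<mapsto> f (r z)\<close>, which
  in turn converges to \<open>f\<close>.
\<close>

section \<open>Lebesgue measure and Gaussian averages on the complex plane\<close>

lemma nn_integral_lborel_translate:
  fixes f :: "'a::euclidean_space \<Rightarrow> ennreal"
  assumes [measurable]: "f \<in> borel_measurable borel"
  shows "(\<integral>\<^sup>+x. f (c + x) \<partial>lborel) = (\<integral>\<^sup>+x. f x \<partial>lborel)"
proof -
  have "(\<integral>\<^sup>+x. f x \<partial>lborel) = (\<integral>\<^sup>+x. f x \<partial>distr lborel borel ((+) c))"
    by (simp add: lborel_distr_plus)
  also have "\<dots> = (\<integral>\<^sup>+x. f (c + x) \<partial>lborel)"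
    by (rule nn_integral_distr) auto
  finally show ?thesis ..
qed

text \<open>
  The image measure is translation invariant, so by Fubini it is a multiple of Lebesgue measure;
  the unit ball, which the transformation preserves, shows that the factor is one.
\<close>

lemma lborel_distr_orthogonal_transformation:
  fixes T :: "'a::euclidean_space \<Rightarrow> 'a"
  assumes T: "orthogonal_transformation T"
  shows "distr lborel borel T = lborel"
proof (rule measure_eqI)
  fix X assume "X \<in> sets (distr lborel borel T)"
  then have X[measurable]: "X \<in> sets borel" by simp
  define S where "S = inv T"
  have S: "orthogonal_transformation S" and TS: "T (S x) = x" and ST: "S (T x) = x" for x
    using T unfolding S_def
    by (simp_all add: orthogonal_transformation_inv orthogonal_transformation_surj surj_f_inv_f
        orthogonal_transformation_inj)
  interpret T: linear T using T by (simp add: orthogonal_transformation_linear)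
  have [measurable]: "T \<in> borel_measurable borel"
    by (intro borel_measurable_continuous_onI linear_continuous_on linear_conv_bounded_linear[THEN iffD1] T.linear_axioms)
  have [measurable]: "ball (0::'a) 1 \<in> sets borel" by simp
  let ?b = "\<lambda>x::'a. indicator (ball 0 1) x :: ennreal"
  let ?v = "emeasure lborel (ball (0::'a) 1)"
  have ball: "(\<integral>\<^sup>+y. ?b (x - T y) \<partial>lborel) = ?v" for x
  proof -
    have "?b (x - T y) = indicator (ball (S x) 1) y" for y
    proof -
      have "norm (x - T y) = norm (T (S x - y))"
        by (simp add: T.diff TS)
      also have "\<dots> = dist (S x) y"
        using T by (simp add: orthogonal_transformation_norm dist_norm)
      finally show ?thesis by (simp add: indicator_def)
    qed
    then have "(\<integral>\<^sup>+y. ?b (x - T y) \<partial>lborel) = emeasure lborel (ball (S x) 1)" by simp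
    then show ?thesis by (simp add: emeasure_ball)
  qed
  have "?v * emeasure (distr lborel borel T) X
      = (\<integral>\<^sup>+x. ?b x * (\<integral>\<^sup>+y. indicator X (T y) \<partial>lborel) \<partial>lborel)"
  proof -
    have "emeasure (distr lborel borel T) X = (\<integral>\<^sup>+y. indicator X y \<partial>distr lborel borel T)" by simp
    also have "\<dots> = (\<integral>\<^sup>+y. indicator X (T y) \<partial>lborel)"
      by (rule nn_integral_distr) auto
    finally show ?thesis by (subst nn_integral_multc) (auto intro: borel_measurable_indicator)
  qed
  also have "\<dots> = (\<integral>\<^sup>+x. (\<integral>\<^sup>+y. ?b x * indicator X (x + T y) \<partial>lborel) \<partial>lborel)"
  proof (rule nn_integral_cong)
    fix x :: 'a
    have "(\<integral>\<^sup>+y. indicator X (T y) \<partial>lborel) = (\<integral>\<^sup>+y. (indicator X (T (S x + y))::ennreal) \<partial>lborel)"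
      by (rule nn_integral_lborel_translate[symmetric]) measurable
    then show "?b x * (\<integral>\<^sup>+y. indicator X (T y) \<partial>lborel) = (\<integral>\<^sup>+y. ?b x * indicator X (x + T y) \<partial>lborel)"
      by (simp add: T.add TS nn_integral_cmult)
  qed
  also have "\<dots> = (\<integral>\<^sup>+y. (\<integral>\<^sup>+x. ?b x * indicator X (x + T y) \<partial>lborel) \<partial>lborel)"
    by (rule lborel_pair.Fubini') measurable
  also have "\<dots> = (\<integral>\<^sup>+y. (\<integral>\<^sup>+x. ?b (x - T y) * indicator X x \<partial>lborel) \<partial>lborel)"
  proof (rule nn_integral_cong)
    fix y :: 'a
    show "(\<integral>\<^sup>+x. ?b x * indicator X (x + T y) \<partial>lborel) = (\<integral>\<^sup>+x. ?b (x - T y) * indicator X x \<partial>lborel)"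
      by (subst nn_integral_lborel_translate[where c="- T y" and f="\<lambda>x. ?b x * indicator X (x + T y)", symmetric])
         (auto simp: algebra_simps)
  qed
  also have "\<dots> = (\<integral>\<^sup>+x. (\<integral>\<^sup>+y. ?b (x - T y) * indicator X x \<partial>lborel) \<partial>lborel)"
    by (rule lborel_pair.Fubini') measurable
  also have "\<dots> = ?v * emeasure lborel X"
    by (simp add: nn_integral_multc ball nn_integral_cmult)
  finally have eq: "?v * emeasure (distr lborel borel T) X = ?v * emeasure lborel X" .
  have v: "?v \<noteq> 0" "?v \<noteq> top"
    using emeasure_bounded_finite[of "ball (0::'a) 1"] unit_ball_vol_pos[of "real DIM('a)"]
    by (auto simp: emeasure_ball simp del: unit_ball_vol_pos)
  show "emeasure (distr lborel borel T) X = emeasure lborel X"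
    using eq v by (simp add: ennreal_mult_cancel_left)
qed simp

lemma orthogonal_transformation_cis: "orthogonal_transformation (\<lambda>z. cis t * z)"
  unfolding orthogonal_transformation
  by (auto simp: norm_mult intro!: linearI simp: algebra_simps)

lemma
  fixes f :: "complex \<Rightarrow> 'a::{banach, second_countable_topology}"
  assumes f: "integrable lborel f"
  shows integrable_rotate: "integrable lborel (\<lambda>z. f (cis t * z))"
    and integral_rotate: "(\<integral>z. f (cis t * z) \<partial>lborel) = (\<integral>z. f z \<partial>lborel)"
proof -
  have *: "distr lborel borel (\<lambda>z. cis t * z) = lborel"
    by (rule lborel_distr_orthogonal_transformation[OF orthogonal_transformation_cis])
  have [measurable]: "f \<in> borel_measurable borel" using f by auto
  show "integrable lborel (\<lambda>z. f (cis t * z))"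
    by (rule integrable_distr[where M'=borel]) (auto simp: * f)
  show "(\<integral>z. f (cis t * z) \<partial>lborel) = (\<integral>z. f z \<partial>lborel)"
    by (subst (2) *[symmetric], subst integral_distr) auto
qed

lemma
  fixes f :: "'a::euclidean_space \<Rightarrow> 'b::{banach, second_countable_topology}"
  assumes f: "integrable lborel f" and c: "c \<noteq> 0"
  shows integrable_lborel_affine: "integrable lborel (\<lambda>x. f (t + c *\<^sub>R x))"
    and integral_lborel_affine:
      "(\<integral>x. f x \<partial>lborel) = \<bar>c\<bar> ^ DIM('a) *\<^sub>R (\<integral>x. f (t + c *\<^sub>R x) \<partial>lborel)"
proof -
  have [measurable]: "f \<in> borel_measurable borel" using f by auto
  have "integrable (density (distr lborel borel (\<lambda>x. t + c *\<^sub>R x)) (\<lambda>_. ennreal (\<bar>c\<bar>^DIM('a)))) f"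
    using f lborel_affine[OF c, of t] by simp
  then have i: "integrable lborel (\<lambda>x. \<bar>c\<bar> ^ DIM('a) *\<^sub>R f (t + c *\<^sub>R x))"
    by (subst (asm) integrable_density) (auto simp: integrable_distr_eq)
  have "integrable lborel (\<lambda>x. (1 / \<bar>c\<bar> ^ DIM('a)) *\<^sub>R \<bar>c\<bar> ^ DIM('a) *\<^sub>R f (t + c *\<^sub>R x))"
    by (rule integrable_scaleR_right) (rule i)
  then show "integrable lborel (\<lambda>x. f (t + c *\<^sub>R x))"
    using c by simp
  show "(\<integral>x. f x \<partial>lborel) = \<bar>c\<bar> ^ DIM('a) *\<^sub>R (\<integral>x. f (t + c *\<^sub>R x) \<partial>lborel)"
    by (subst lborel_affine[OF c, of t], subst integral_density) (auto simp: integral_distr)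
qed

lemma integrable_lborel_translate:
  fixes f :: "'a::euclidean_space \<Rightarrow> 'b::{banach, second_countable_topology}"
  shows "integrable lborel f \<Longrightarrow> integrable lborel (\<lambda>x. f (t + x))"
  using integrable_lborel_affine[of f 1 t] by simp

lemma integral_lborel_translate:
  fixes f :: "'a::euclidean_space \<Rightarrow> 'b::{banach, second_countable_topology}"
  shows "integrable lborel f \<Longrightarrow> (\<integral>x. f (t + x) \<partial>lborel) = (\<integral>x. f x \<partial>lborel)"
  using integral_lborel_affine[of f 1 t] by simp

section \<open>Gaussian integrals on the plane\<close>

lemma has_bochner_integral_gaussian:
  "has_bochner_integral lborel (\<lambda>z::complex. exp (- (cmod z)\<^sup>2)) pi"
proof (rule has_bochner_integral_nn_integral)
  \<comment> \<open>The half-line integral \<open>sqrt pi / 2\<close> doubles by evenness; the plane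
    integral then factors over the two coordinates.\<close>
  have "has_bochner_integral lborel (\<lambda>x::real. exp (- x\<^sup>2)) (2 * (sqrt pi / 2))"
    using has_bochner_integral_even_function[OF gaussian_moment_0] by (simp add: scaleR_2)
  then have 1: "(\<integral>\<^sup>+x. ennreal (exp (- (x::real)\<^sup>2)) \<partial>lborel) = ennreal (sqrt pi)"
    by (subst nn_integral_eq_integral) (auto simp: has_bochner_integral_iff)
  have "(\<integral>\<^sup>+z. ennreal (exp (- (cmod z)\<^sup>2)) \<partial>lborel)
    = (\<integral>\<^sup>+z. (\<Prod>b\<in>Basis. ennreal (exp (- ((z::complex) \<bullet> b)\<^sup>2))) \<partial>lborel)"
    by (rule nn_integral_cong)
       (simp add: Basis_complex_def cmod_power2 ennreal_mult[symmetric] exp_add[symmetric])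
  also have "\<dots> = (\<Prod>b\<in>(Basis::complex set). \<integral>\<^sup>+x. ennreal (exp (- (x::real)\<^sup>2)) \<partial>lborel)"
    by (rule nn_integral_lborel_prod) auto
  also have "\<dots> = ennreal pi"
    by (simp add: 1 Basis_complex_def ennreal_mult[symmetric])
  finally show "(\<integral>\<^sup>+z. ennreal (exp (- (cmod z)\<^sup>2)) \<partial>lborel) = ennreal pi" .
qed auto

lemma integrable_gaussian:
  assumes "c > 0"
  shows "integrable lborel (\<lambda>z::complex. exp (- (c * (cmod z)\<^sup>2)))"
  using integrable_lborel_affine[of "\<lambda>z::complex. exp (- (cmod z)\<^sup>2)" "sqrt c" 0]
    has_bochner_integral_gaussian assms
  by (simp add: has_bochner_integral_iff power_mult_distrib)

section \<open>Mean value property of entire functions\<close>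

lemma holomorphic_on_compose_entire:
  "f holomorphic_on UNIV \<Longrightarrow> g holomorphic_on A \<Longrightarrow> (\<lambda>z. f (g z)) holomorphic_on A"
  using holomorphic_on_compose_gen[of g A f UNIV] by (simp add: o_def)

text \<open>Cauchy's integral formula at the centre of the unit circle. Applying it to
  \<open>u \<mapsto> f (u * z)\<close> keeps the contour fixed for all \<open>z\<close>, including
  \<open>z = 0\<close>.\<close>

lemma integral_circle_mean_value:
  fixes f :: "complex \<Rightarrow> complex"
  assumes "f holomorphic_on UNIV"
  shows "(\<integral>t. indicator {0..1} t *\<^sub>R f (cis (2 * pi * t) * z) \<partial>lborel) = f 0"
proof -
  define g where "g u = f (u * z)" for u
  have g: "g holomorphic_on A" for A
    unfolding g_def by (intro holomorphic_on_compose_entire[OF assms] holomorphic_intros)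
  have "((\<lambda>u. g u / (u - 0)) has_contour_integral 2 * of_real pi * \<i> * g 0) (circlepath 0 1)"
    by (rule Cauchy_integral_circlepath_simple) (auto intro: g)
  then have "((\<lambda>t::real. g (exp (2 * pi * \<i> * t)) / exp (2 * pi * \<i> * t) * (2 * pi * \<i> * exp (2 * pi * \<i> * t)))
       has_integral 2 * of_real pi * \<i> * g 0) {0..1}"
    unfolding has_contour_integral_def
    by (rule has_integral_eq[rotated], simp add: vector_derivative_circlepath01) (simp add: circlepath)
  then have "((\<lambda>t::real. 1 / (2 * pi * \<i>) * (2 * pi * \<i> * g (exp (2 * pi * \<i> * t))))
       has_integral 1 / (2 * pi * \<i>) * (2 * of_real pi * \<i> * g 0)) {0..1}"
    by (intro has_integral_mult_right) (simp add: mult_ac)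
  then have *: "((\<lambda>t. g (cis (2 * pi * t))) has_integral g 0) {0..1}"
    by (simp add: cis_conv_exp mult_ac)
  have "continuous_on {0..1} (\<lambda>t. g (cis (2 * pi * t)))"
    by (intro continuous_on_compose2[OF holomorphic_on_imp_continuous_on[OF g[of UNIV]]] continuous_intros) auto
  then have i: "set_integrable lborel {0..1} (\<lambda>t. g (cis (2 * pi * t)))"
    by (rule borel_integrable_atLeastAtMost')
  have "(LINT t:{0..1}|lborel. g (cis (2 * pi * t))) = g 0"
    using set_borel_integral_eq_integral(2)[OF i] integral_unique[OF *] by simp
  then show ?thesis by (simp add: g_def set_lebesgue_integral_def)
qed

text \<open>Lebesgue measure and the weight are rotation invariant, so averaging the integral over
  all rotations does not change it. Fubini moves the average inside, where the circle mean value
  turns \<open>f\<close> into the constant \<open>f 0\<close>.\<close>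

lemma gaussian_mean_value:
  assumes f: "f holomorphic_on UNIV"
    and i: "integrable lborel (\<lambda>z. f z * of_real (exp (- (cmod z)\<^sup>2)))"
  shows "(\<integral>z. f z * of_real (exp (- (cmod z)\<^sup>2)) \<partial>lborel) = of_real pi * f 0"
proof -
  have [measurable]: "f \<in> borel_measurable borel"
    using f by (intro borel_measurable_continuous_onI holomorphic_on_imp_continuous_on)
  let ?w = "\<lambda>z. of_real (exp (- (cmod z)\<^sup>2)) :: complex"
  let ?F = "\<lambda>(t::real) z. indicator {0..1} t *\<^sub>R (f (cis (2 * pi * t) * z) * ?w z)"
  have rot: "integrable lborel (\<lambda>z. f (cis t * z) * ?w z)"
       "(\<integral>z. f (cis t * z) * ?w z \<partial>lborel) = (\<integral>z. f z * ?w z \<partial>lborel)" for t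
    using integrable_rotate[OF i, of t] integral_rotate[OF i, of t] by (simp_all add: norm_mult)
  have rotn: "(\<integral>z. norm (f (cis t * z) * ?w z) \<partial>lborel) = (\<integral>z. norm (f z * ?w z) \<partial>lborel)" for t
    using integral_rotate[OF integrable_norm[OF i], of t] by (simp add: norm_mult)
  have ind: "integrable lborel (indicator {0..1} :: real \<Rightarrow> real)" by simp
  \<comment> \<open>Rotation invariance gives all slices with \<open>t\<close> in
    \<open>{0..1}\<close> the same finite norm integral, so the double integral converges
    absolutely.\<close>
  have F: "integrable (lborel \<Otimes>\<^sub>M lborel) (\<lambda>(t, z). ?F t z)"
  proof (rule lborel_pair.Fubini_integrable)
    have [measurable]: "cis \<in> borel_measurable borel"
      by (intro borel_measurable_continuous_onI continuous_intros)
    show "(\<lambda>(t, z). ?F t z) \<in> borel_measurable (lborel \<Otimes>\<^sub>M lborel)" by measurable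
    show "AE t in lborel. integrable lborel (\<lambda>z. case (t, z) of (t, z) \<Rightarrow> ?F t z)"
      using rot by (intro always_eventually allI) (simp)
    have "(\<integral>z. norm (case (t, z) of (t, z) \<Rightarrow> ?F t z) \<partial>lborel)
       = indicator {0..1} t * (\<integral>z. norm (f z * ?w z) \<partial>lborel)" for t
      using rotn[of "2 * pi * t"] by (simp add: norm_mult)
    then have "(\<lambda>t. \<integral>z. norm (case (t, z) of (t, z) \<Rightarrow> ?F t z) \<partial>lborel)
       = (\<lambda>t. indicator {0..1} t * (\<integral>z. norm (f z * ?w z) \<partial>lborel))" by (rule ext)
    then show "integrable lborel (\<lambda>t. \<integral>z. norm (case (t, z) of (t, z) \<Rightarrow> ?F t z) \<partial>lborel)"
      using ind by (simp only:) (intro integrable_mult_left)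
  qed
  have "(\<integral>z. f z * ?w z \<partial>lborel) = (\<integral>t. indicator {0..1} (t::real) *\<^sub>R (\<integral>z. f z * ?w z \<partial>lborel) \<partial>lborel)"
    using ind by simp
  also have "\<dots> = (\<integral>t. (\<integral>z. ?F t z \<partial>lborel) \<partial>lborel)"
    using rot(2) by simp
  also have "\<dots> = (\<integral>z. (\<integral>t. ?F t z \<partial>lborel) \<partial>lborel)"
    using lborel_pair.Fubini_integral[OF F] by simp
  also have "\<dots> = (\<integral>z. f 0 * ?w z \<partial>lborel)"
  proof (rule Bochner_Integration.integral_cong[OF refl])
    fix z
    have "(\<integral>t. ?F t z \<partial>lborel) = (\<integral>t. (indicator {0..1} t *\<^sub>R f (cis (2 * pi * t) * z)) * ?w z \<partial>lborel)"
      by simp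
    also have "\<dots> = f 0 * ?w z"
      by (subst integral_mult_left_zero) (simp add: integral_circle_mean_value[OF f])
    finally show "(\<integral>t. ?F t z \<partial>lborel) = f 0 * ?w z" .
  qed
  also have "\<dots> = of_real pi * f 0"
    using has_bochner_integral_gaussian by (simp add: has_bochner_integral_iff)
  finally show ?thesis .
qed

section \<open>Reproducing kernel of the Fock space\<close>

lemma fock_space_holomorphic: "f \<in> fock_space \<Longrightarrow> f holomorphic_on A"
  by (auto simp: fock_space_def intro: holomorphic_on_subset)

lemma fock_space_integrable:
  "f \<in> fock_space \<Longrightarrow> integrable lborel (\<lambda>z. (cmod (f z))\<^sup>2 * exp (- (cmod z)\<^sup>2))"
  by (simp add: fock_space_def)

lemma holomorphic_borel_measurable:
  "f holomorphic_on UNIV \<Longrightarrow> f \<in> borel_measurable borel"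
  by (intro borel_measurable_continuous_onI holomorphic_on_imp_continuous_on)

lemma fock_space_borel_measurable: "f \<in> fock_space \<Longrightarrow> f \<in> borel_measurable borel"
  by (simp add: holomorphic_borel_measurable fock_space_holomorphic)

text \<open>Squaring doubles the rate \<open>c\<close>, and \<open>2 * c < 1\<close> leaves Gaussian
  decay of rate \<open>1 - 2 * c\<close> against the weight.\<close>

lemma fock_spaceI_growth:
  assumes f: "f holomorphic_on UNIV" and c: "c < 1 / 2"
    and le: "\<And>z. cmod (f z) \<le> M * exp (c * (cmod z)\<^sup>2)"
  shows "f \<in> fock_space"
proof -
  have "integrable lborel (\<lambda>z. (cmod (f z))\<^sup>2 * exp (- (cmod z)\<^sup>2))"
  proof (rule Bochner_Integration.integrable_bound)
    show "integrable lborel (\<lambda>z::complex. M\<^sup>2 * exp (- ((1 - 2 * c) * (cmod z)\<^sup>2)))"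
      using c by (intro integrable_mult_right integrable_gaussian) auto
    show "(\<lambda>z. (cmod (f z))\<^sup>2 * exp (- (cmod z)\<^sup>2)) \<in> borel_measurable lborel"
      using holomorphic_borel_measurable[OF f] by measurable
    have "(cmod (f z))\<^sup>2 * exp (- (cmod z)\<^sup>2) \<le> M\<^sup>2 * exp (- ((1 - 2 * c) * (cmod z)\<^sup>2))" for z
    proof -
      have "(cmod (f z))\<^sup>2 \<le> (M * exp (c * (cmod z)\<^sup>2))\<^sup>2"
        using le by (intro power_mono) auto
      also have "\<dots> = M\<^sup>2 * exp (2 * c * (cmod z)\<^sup>2)"
        by (simp add: power_mult_distrib flip: exp_double)
      finally have "(cmod (f z))\<^sup>2 * exp (- (cmod z)\<^sup>2)
          \<le> M\<^sup>2 * exp (2 * c * (cmod z)\<^sup>2) * exp (- (cmod z)\<^sup>2)"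
        by (rule mult_right_mono) simp
      then show ?thesis by (simp add: mult.assoc exp_add[symmetric] algebra_simps)
    qed
    then show "AE z in lborel. norm ((cmod (f z))\<^sup>2 * exp (- (cmod z)\<^sup>2))
        \<le> norm (M\<^sup>2 * exp (- ((1 - 2 * c) * (cmod z)\<^sup>2)))"
      by (intro always_eventually) simp
  qed
  with f show ?thesis by (simp add: fock_space_def)
qed

text \<open>Completing the square. It absorbs linear exponents into an arbitrarily small share of
  the Gaussian, and later splits a product into a fixed part and a small multiple of a
  square.\<close>

lemma linear_le_quadratic:
  fixes k t c :: real
  assumes "c > 0"
  shows "k * t \<le> k\<^sup>2 / (4 * c) + c * t\<^sup>2"
proof -
  have "0 \<le> (k / (2 * c) - t)\<^sup>2 * c" using assms by simp
  also have "\<dots> = k\<^sup>2 / (4 * c) + c * t\<^sup>2 - k * t"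
    using assms by (simp add: field_simps power2_eq_square)
  finally show ?thesis by simp
qed

lemma fock_spaceI_exponential_type:
  assumes f: "f holomorphic_on UNIV" and M: "M \<ge> 0"
    and le: "\<And>z. cmod (f z) \<le> M * exp (k * cmod z)"
  shows "f \<in> fock_space"
\<comment> \<open>The rate \<open>1 / 4\<close> is a convenient choice below \<open>1 / 2\<close>:
  the constant from completing the square is then exactly \<open>k\<^sup>2\<close>.\<close>
proof (rule fock_spaceI_growth[OF f, of "1 / 4" "M * exp (k\<^sup>2)"])
  fix z
  have "cmod (f z) \<le> M * exp (k * cmod z)" by (rule le)
  also have "\<dots> \<le> M * exp (k\<^sup>2 + 1 / 4 * (cmod z)\<^sup>2)"
    using linear_le_quadratic[of "1/4" k "cmod z"] M by (intro mult_left_mono) auto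
  finally show "cmod (f z) \<le> M * exp (k\<^sup>2) * exp (1 / 4 * (cmod z)\<^sup>2)"
    by (simp add: exp_add)
qed simp

lemma cmod_exp_le: "cmod (exp z) \<le> exp (cmod z)"
  by (simp add: complex_Re_le_cmod)

lemma exp_in_fock_space: "(\<lambda>z. exp (c * z)) \<in> fock_space"
  using cmod_exp_le[of "c * _"]
  by (intro fock_spaceI_exponential_type[where M=1 and k="cmod c"]) (auto simp: norm_mult intro!: holomorphic_intros)

text \<open>In this form translations of the weight become algebra in \<open>z\<close> and
  \<open>cnj z\<close> inside one exponent.\<close>

lemma of_real_exp_cmod: "complex_of_real (exp (- (cmod z)\<^sup>2)) = exp (- (z * cnj z))"
  by (simp add: complex_norm_square[symmetric] flip: exp_of_real)

section \<open>Square integrable functions and the weighted inner product\<close>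

lemma mult_le_sum_squares:
  fixes a b :: real
  assumes "0 \<le> a" "0 \<le> b"
  shows "a * b \<le> a\<^sup>2 + b\<^sup>2"
  using sum_squares_bound[of a b] mult_nonneg_nonneg[OF assms] by linarith

lemma borel_measurable_cnj [measurable]: "cnj \<in> borel_measurable borel"
  by (intro borel_measurable_continuous_onI continuous_intros)

lemma integrable_mult_cnj_L2:
  fixes f g :: "'a \<Rightarrow> complex"
  assumes [measurable]: "f \<in> borel_measurable M" "g \<in> borel_measurable M"
    and "integrable M (\<lambda>x. (cmod (f x))\<^sup>2)" "integrable M (\<lambda>x. (cmod (g x))\<^sup>2)"
  shows "integrable M (\<lambda>x. f x * cnj (g x))"
proof (rule Bochner_Integration.integrable_bound)
  show "integrable M (\<lambda>x. (cmod (f x))\<^sup>2 + (cmod (g x))\<^sup>2)"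
    using assms by simp
  have "cmod (f x) * cmod (g x) \<le> (cmod (f x))\<^sup>2 + (cmod (g x))\<^sup>2" for x
    by (rule mult_le_sum_squares) auto
  then show "AE x in M. norm (f x * cnj (g x)) \<le> norm ((cmod (f x))\<^sup>2 + (cmod (g x))\<^sup>2)"
    by (intro always_eventually) (simp add: norm_mult)
qed measurable

text \<open>Multiplying by the square root of the weight embeds the Fock space into unweighted L2,
  up to the factor \<open>pi\<close>, so general L2 arguments apply.\<close>

definition gauss_weight :: "(complex \<Rightarrow> complex) \<Rightarrow> complex \<Rightarrow> complex" where
  "gauss_weight f z = f z * of_real (exp (- (cmod z)\<^sup>2 / 2))"

lemma gauss_weight_measurable [measurable (raw)]:
  "f \<in> borel_measurable borel \<Longrightarrow> gauss_weight f \<in> borel_measurable borel"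
  unfolding gauss_weight_def[abs_def]
  by (intro borel_measurable_times[OF _ borel_measurable_continuous_onI] continuous_intros) auto

lemma cmod_gauss_weight_sq: "(cmod (gauss_weight f z))\<^sup>2 = (cmod (f z))\<^sup>2 * exp (- (cmod z)\<^sup>2)"
  by (simp add: gauss_weight_def norm_mult power_mult_distrib flip: exp_double)

lemma gauss_weight_mult_cnj:
  "gauss_weight f z * cnj (gauss_weight g z) = f z * cnj (g z) * of_real (exp (- (cmod z)\<^sup>2))"
proof -
  have "gauss_weight f z * cnj (gauss_weight g z)
     = f z * cnj (g z) * of_real (exp (- (cmod z)\<^sup>2 / 2) * exp (- (cmod z)\<^sup>2 / 2))"
    by (simp add: gauss_weight_def)
  then show ?thesis by (simp only: exp_add[symmetric]) simp
qed

lemma fock_inner_gauss_weight: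
  "fock_inner f g = 1 / of_real pi * (\<integral>z. gauss_weight f z * cnj (gauss_weight g z) \<partial>lborel)"
  by (simp add: fock_inner_def gauss_weight_mult_cnj)

lemma integrable_fock_inner:
  assumes "f \<in> fock_space" "g \<in> fock_space"
  shows "integrable lborel (\<lambda>z. f z * cnj (g z) * of_real (exp (- (cmod z)\<^sup>2)))"
  unfolding gauss_weight_mult_cnj[symmetric]
  using assms
  by (intro integrable_mult_cnj_L2)
     (auto simp: cmod_gauss_weight_sq fock_space_integrable fock_space_borel_measurable
       intro: gauss_weight_measurable)

lemma cnj_fock_inner: "cnj (fock_inner f g) = fock_inner g f"
  by (simp add: fock_inner_def mult_ac flip: Bochner_Integration.integral_cnj)

text \<open>Translating by \<open>u\<close> cancels the antiholomorphic factor of the kernel against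
  the weight. What remains is an entire function times the centred Gaussian, whose value at
  \<open>0\<close> is \<open>f u\<close>.\<close>

lemma
  assumes f: "f \<in> fock_space"
  shows integrable_fock_kernel:
      "integrable lborel (\<lambda>w. f w * exp (u * cnj w) * of_real (exp (- (cmod w)\<^sup>2)))"
    and integral_fock_kernel:
      "(\<integral>w. f w * exp (u * cnj w) * of_real (exp (- (cmod w)\<^sup>2)) \<partial>lborel) = of_real pi * f u"
proof -
  let ?H = "\<lambda>w. f w * exp (u * cnj w) * of_real (exp (- (cmod w)\<^sup>2))"
  show i: "integrable lborel ?H"
    using integrable_fock_inner[OF f exp_in_fock_space[of "cnj u"]] by (simp add: exp_cnj)
  have H: "?H (u + w) = f (u + w) * exp (- (cnj u * w)) * of_real (exp (- (cmod w)\<^sup>2))" for w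
    unfolding of_real_exp_cmod mult.assoc exp_add[symmetric] by (simp add: algebra_simps)
  have "(\<lambda>w. f (u + w) * exp (- (cnj u * w))) holomorphic_on UNIV"
    by (intro holomorphic_intros holomorphic_on_compose_entire[OF fock_space_holomorphic[OF f]])
  from gaussian_mean_value[OF this] integrable_lborel_translate[OF i, of u]
  have "(\<integral>w. ?H (u + w) \<partial>lborel) = of_real pi * f u" unfolding H by simp
  then show "(\<integral>w. ?H w \<partial>lborel) = of_real pi * f u"
    using integral_lborel_translate[OF i, of u] by simp
qed

lemma fock_inner_kernel:
  assumes "f \<in> fock_space"
  shows "fock_inner f (\<lambda>z. exp (cnj u * z)) = f u"
  using integral_fock_kernel[OF assms, of u] by (simp add: fock_inner_def exp_cnj)

text \<open>The reproducing formula is estimated with the inequality of arithmetic and geometric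
  means instead of Cauchy-Schwarz. Only the growth rate matters, so the constant may depend on
  \<open>f\<close> in a non-homogeneous way.\<close>

lemma fock_space_pointwise_bound:
  assumes f: "f \<in> fock_space"
  obtains M where "M \<ge> 0" "\<And>u. cmod (f u) \<le> M * exp ((cmod u)\<^sup>2 / 2)"
proof
  define I where "I = (\<integral>z. (cmod (f z))\<^sup>2 * exp (- (cmod z)\<^sup>2) \<partial>lborel)"
  have "I \<ge> 0" by (simp add: I_def)
  then show "(I + pi) / (2 * pi) \<ge> 0" by simp
  fix u
  have gi: "integrable lborel (\<lambda>w. exp (- (cmod (- u + w))\<^sup>2))"
    and gI: "(\<integral>w. exp (- (cmod (- u + w))\<^sup>2) \<partial>lborel) = pi"
    using has_bochner_integral_gaussian
      integrable_lborel_translate[of "\<lambda>w. exp (- (cmod w)\<^sup>2)" "- u"]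
      integral_lborel_translate[of "\<lambda>w. exp (- (cmod w)\<^sup>2)" "- u"]
    by (auto simp: has_bochner_integral_iff)
  let ?b = "\<lambda>w. exp ((cmod u)\<^sup>2 / 2) / 2 * ((cmod (f w))\<^sup>2 * exp (- (cmod w)\<^sup>2) + exp (- (cmod (- u + w))\<^sup>2))"
  have bound: "norm (f w * exp (u * cnj w) * of_real (exp (- (cmod w)\<^sup>2))) \<le> ?b w" for w
  proof -
    let ?p = "cmod (f w) * exp (- (cmod w)\<^sup>2 / 2)" and ?q = "exp (- (cmod (- u + w))\<^sup>2 / 2)"
    \<comment> \<open>Completing the square: half of the weight stays with \<open>f\<close>, and the
      kernel times the other half is \<open>exp ((cmod u)\<^sup>2 / 2)\<close> times the square root
      of a Gaussian centred at \<open>u\<close>, in absolute value.\<close>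
    have "Re (u * cnj w) - (cmod w)\<^sup>2 = (cmod u)\<^sup>2 / 2 + (- (cmod w)\<^sup>2 / 2 + - (cmod (- u + w))\<^sup>2 / 2)"
      unfolding cmod_power2 by (simp add: power2_eq_square field_simps)
    then have "norm (f w * exp (u * cnj w) * of_real (exp (- (cmod w)\<^sup>2)))
      = cmod (f w) * exp ((cmod u)\<^sup>2 / 2 + (- (cmod w)\<^sup>2 / 2 + - (cmod (- u + w))\<^sup>2 / 2))"
      by (simp add: norm_mult mult.assoc exp_add[symmetric])
    also have "\<dots> = exp ((cmod u)\<^sup>2 / 2) / 2 * (2 * ?p * ?q)"
      by (simp only: exp_add) simp
    also have "\<dots> \<le> exp ((cmod u)\<^sup>2 / 2) / 2 * (?p\<^sup>2 + ?q\<^sup>2)"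
      by (intro mult_left_mono sum_squares_bound) simp
    also have "\<dots> = ?b w"
      by (simp add: power_mult_distrib flip: exp_double)
    finally show ?thesis .
  qed
  have bi: "integrable lborel ?b"
    using gi fock_space_integrable[OF f] by (intro integrable_mult_right Bochner_Integration.integrable_add)
  have "pi * cmod (f u) = norm (\<integral>w. f w * exp (u * cnj w) * of_real (exp (- (cmod w)\<^sup>2)) \<partial>lborel)"
    by (simp add: integral_fock_kernel[OF f] norm_mult)
  also have "\<dots> \<le> (\<integral>w. ?b w \<partial>lborel)"
    by (intro Bochner_Integration.integral_norm_bound_integral integrable_fock_kernel[OF f] bi bound)
  also have "\<dots> = exp ((cmod u)\<^sup>2 / 2) / 2 * (I + pi)"
    using gi fock_space_integrable[OF f] gI by (simp add: I_def)
  finally show "cmod (f u) \<le> (I + pi) / (2 * pi) * exp ((cmod u)\<^sup>2 / 2)"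
    by (simp add: field_simps)
qed

section \<open>Contractive symbols\<close>

text \<open>A product of two square integrable functions: \<open>f\<close> takes the exponent
  \<open>1 / 2\<close>, and the surplus \<open>d\<close> absorbs the linear term of the other
  factor.\<close>

lemma integrable_fock_gauss:
  assumes f: "f \<in> fock_space" and d: "d > 0"
  shows "integrable lborel (\<lambda>w. cmod (f w) * exp (b * cmod w - (1 / 2 + d) * (cmod w)\<^sup>2))"
proof (rule Bochner_Integration.integrable_bound)
  let ?B = "\<lambda>w. (cmod (f w))\<^sup>2 * exp (- (cmod w)\<^sup>2) + exp (b\<^sup>2 / d) * exp (- (d * (cmod w)\<^sup>2))"
  show "integrable lborel ?B"
    using d by (intro Bochner_Integration.integrable_add fock_space_integrable[OF f]
        integrable_mult_right integrable_gaussian)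
  show "(\<lambda>w. cmod (f w) * exp (b * cmod w - (1 / 2 + d) * (cmod w)\<^sup>2)) \<in> borel_measurable lborel"
    using fock_space_borel_measurable[OF f] by measurable
  have "cmod (f w) * exp (b * cmod w - (1 / 2 + d) * (cmod w)\<^sup>2) \<le> ?B w" for w
  proof -
    let ?p = "cmod (f w) * exp (- (cmod w)\<^sup>2 / 2)" and ?q = "exp (b * cmod w - d * (cmod w)\<^sup>2)"
    have "cmod (f w) * exp (b * cmod w - (1 / 2 + d) * (cmod w)\<^sup>2) = ?p * ?q"
      by (simp add: mult.assoc exp_add[symmetric] algebra_simps)
    also have "\<dots> \<le> ?p\<^sup>2 + ?q\<^sup>2"
      by (rule mult_le_sum_squares) auto
    also have "?p\<^sup>2 = (cmod (f w))\<^sup>2 * exp (- (cmod w)\<^sup>2)"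
      by (simp add: power_mult_distrib flip: exp_double)
    also have "?q\<^sup>2 = exp (2 * (b * cmod w - d * (cmod w)\<^sup>2))"
      by (rule exp_double[symmetric])
    also have "\<dots> \<le> exp (b\<^sup>2 / d + - (d * (cmod w)\<^sup>2))"
      using linear_le_quadratic[OF d, of "2 * b" "cmod w"] by (simp add: power_mult_distrib algebra_simps)
    finally show ?thesis unfolding exp_add by simp
  qed
  then show "AE w in lborel. norm (cmod (f w) * exp (b * cmod w - (1 / 2 + d) * (cmod w)\<^sup>2)) \<le> norm (?B w)"
    by (intro always_eventually allI) (simp add: order_trans[OF _ abs_ge_self])
qed

text \<open>Both sides are iterated integrals of one kernel \<open>K\<close>. Integrating over
  \<open>w\<close> reproduces \<open>f\<close> at \<open>A * z + B\<close>; integrating over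
  \<open>z\<close> reproduces \<open>g\<close> at \<open>cnj A * w + cnj D\<close>.\<close>

lemma fock_inner_weighted_comp_contraction:
  assumes f: "f \<in> fock_space" and g: "g \<in> fock_space" and A: "cmod A < 1"
  shows "fock_inner (\<lambda>z. C * exp (D * z) * f (A * z + B)) g
       = fock_inner f (\<lambda>z. cnj C * exp (cnj B * z) * g (cnj A * z + cnj D))"
proof -
  note [measurable] = fock_space_borel_measurable[OF f] fock_space_borel_measurable[OF g]
  let ?E = "\<lambda>z. of_real (exp (- (cmod z)\<^sup>2)) :: complex"
  define K where "K z w = C * exp (D * z) * cnj (g z) * ?E z * (f w * exp ((A * z + B) * cnj w) * ?E w)" for z w
  \<comment> \<open>The mixed term costs the rate \<open>cmod A / 2\<close> in each variable, and
    \<open>1 - cmod A / 2\<close> equals \<open>1 / 2 + d\<close>.\<close>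
  define d where "d = (1 - cmod A) / 2"
  have d: "d > 0" using A by (simp add: d_def)
  let ?P = "\<lambda>w. cmod (f w) * exp (cmod B * cmod w - (1 / 2 + d) * (cmod w)\<^sup>2)"
  let ?Q = "\<lambda>z. cmod (g z) * exp (cmod D * cmod z - (1 / 2 + d) * (cmod z)\<^sup>2)"
  have bound: "norm (K z w) \<le> cmod C * ?Q z * ?P w" for z w
  proof -
    have "cmod A * (2 * cmod z * cmod w) \<le> cmod A * ((cmod z)\<^sup>2 + (cmod w)\<^sup>2)"
      by (intro mult_left_mono sum_squares_bound) simp
    then have A: "cmod (A * z * cnj w) \<le> cmod A / 2 * (cmod z)\<^sup>2 + cmod A / 2 * (cmod w)\<^sup>2"
      by (simp add: norm_mult algebra_simps)
    have "Re (D * z) + - (cmod z)\<^sup>2 + (Re ((A * z + B) * cnj w) + - (cmod w)\<^sup>2)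
       \<le> cmod (D * z) + cmod (A * z * cnj w) + cmod (B * cnj w) - (cmod z)\<^sup>2 - (cmod w)\<^sup>2"
      using complex_Re_le_cmod[of "D * z"] complex_Re_le_cmod[of "A * z * cnj w"]
        complex_Re_le_cmod[of "B * cnj w"] unfolding distrib_right plus_complex.sel by linarith
    also have "\<dots> \<le> (cmod D * cmod z - (1 / 2 + d) * (cmod z)\<^sup>2) + (cmod B * cmod w - (1 / 2 + d) * (cmod w)\<^sup>2)"
      using A by (simp add: norm_mult d_def) (simp add: field_simps)
    finally have e: "exp (Re (D * z) + - (cmod z)\<^sup>2 + (Re ((A * z + B) * cnj w) + - (cmod w)\<^sup>2))
       \<le> exp ((cmod D * cmod z - (1 / 2 + d) * (cmod z)\<^sup>2) + (cmod B * cmod w - (1 / 2 + d) * (cmod w)\<^sup>2))"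
      by simp
    have "norm (K z w) = cmod C * cmod (g z) * cmod (f w) *
        exp (Re (D * z) + - (cmod z)\<^sup>2 + (Re ((A * z + B) * cnj w) + - (cmod w)\<^sup>2))"
      unfolding K_def exp_add by (simp add: norm_mult mult_ac)
    also have "\<dots> \<le> cmod C * cmod (g z) * cmod (f w) *
        exp ((cmod D * cmod z - (1 / 2 + d) * (cmod z)\<^sup>2) + (cmod B * cmod w - (1 / 2 + d) * (cmod w)\<^sup>2))"
      using e by (intro mult_left_mono) auto
    also have "\<dots> = cmod C * ?Q z * ?P w" unfolding exp_add by (simp add: mult_ac)
    finally show ?thesis .
  qed
  note P = integrable_fock_gauss[OF f d, of "cmod B"] and Q = integrable_fock_gauss[OF g d, of "cmod D"]
  have [measurable]: "(\<lambda>(z, w). K z w) \<in> borel_measurable (lborel \<Otimes>\<^sub>M lborel)"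
    unfolding K_def by measurable
  have "integrable (lborel \<Otimes>\<^sub>M lborel) (\<lambda>(z, w). cmod C * ?Q z * ?P w)"
  proof (rule lborel_pair.Fubini_integrable)
    show "(\<lambda>(z, w). cmod C * ?Q z * ?P w) \<in> borel_measurable (lborel \<Otimes>\<^sub>M lborel)" by measurable
    show "AE z in lborel. integrable lborel (\<lambda>w. case (z, w) of (z, w) \<Rightarrow> cmod C * ?Q z * ?P w)"
      using P by (intro always_eventually allI) (simp only: prod.case, intro integrable_mult_right)
    have "(\<lambda>z. \<integral>w. norm (case (z, w) of (z, w) \<Rightarrow> cmod C * ?Q z * ?P w) \<partial>lborel)
       = (\<lambda>z. ?Q z * (cmod C * (\<integral>w. ?P w \<partial>lborel)))"
    proof
      fix z
      have "(\<integral>w. norm (case (z, w) of (z, w) \<Rightarrow> cmod C * ?Q z * ?P w) \<partial>lborel)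
        = (\<integral>w. cmod C * ?Q z * ?P w \<partial>lborel)"
        by (simp add: abs_mult)
      then show "(\<integral>w. norm (case (z, w) of (z, w) \<Rightarrow> cmod C * ?Q z * ?P w) \<partial>lborel)
        = ?Q z * (cmod C * (\<integral>w. ?P w \<partial>lborel))"
        by (simp only: integral_mult_right_zero) (simp add: mult_ac)
    qed
    then show "integrable lborel (\<lambda>z. \<integral>w. norm (case (z, w) of (z, w) \<Rightarrow> cmod C * ?Q z * ?P w) \<partial>lborel)"
      using Q by (simp only:) (intro integrable_mult_left)
  qed
  then have K: "integrable (lborel \<Otimes>\<^sub>M lborel) (\<lambda>(z, w). K z w)"
    by (rule Bochner_Integration.integrable_bound)
       (use bound in \<open>auto intro!: always_eventually order_trans[OF _ abs_ge_self]\<close>)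
  have Kw: "(\<integral>w. K z w \<partial>lborel) = of_real pi * (C * exp (D * z) * f (A * z + B) * cnj (g z) * ?E z)" for z
    unfolding K_def by (simp add: integral_fock_kernel[OF f])
  have Kz: "(\<integral>z. K z w \<partial>lborel)
      = of_real pi * (f w * cnj (cnj C * exp (cnj B * w) * g (cnj A * w + cnj D)) * ?E w)" for w
  proof -
    \<comment> \<open>After conjugation, the factors depending on \<open>z\<close> form the
      reproducing integrand of \<open>g\<close>.\<close>
    have "K z w = (C * f w * exp (B * cnj w) * ?E w) * cnj (g z * exp ((cnj A * w + cnj D) * cnj z) * ?E z)" for z
      unfolding K_def by (simp add: exp_cnj exp_add algebra_simps)
    then have "(\<integral>z. K z w \<partial>lborel) = (C * f w * exp (B * cnj w) * ?E w) *
        cnj (\<integral>z. g z * exp ((cnj A * w + cnj D) * cnj z) * ?E z \<partial>lborel)"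
      by (simp only: integral_mult_right_zero Bochner_Integration.integral_cnj)
    then show ?thesis by (simp add: integral_fock_kernel[OF g] exp_cnj)
  qed
  have "of_real pi * (\<integral>z. C * exp (D * z) * f (A * z + B) * cnj (g z) * ?E z \<partial>lborel) = (\<integral>z. (\<integral>w. K z w \<partial>lborel) \<partial>lborel)"
    unfolding Kw by simp
  also have "\<dots> = (\<integral>w. (\<integral>z. K z w \<partial>lborel) \<partial>lborel)"
    by (rule lborel_pair.Fubini_integral[OF K, symmetric])
  also have "\<dots> = of_real pi * (\<integral>w. f w * cnj (cnj C * exp (cnj B * w) * g (cnj A * w + cnj D)) * ?E w \<partial>lborel)"
    unfolding Kz by simp
  finally show ?thesis unfolding fock_inner_def by simp
qed

section \<open>Weak convergence in L2\<close>

lemma cmod_diff_sq_le: "(cmod (x - y))\<^sup>2 \<le> 2 * (cmod x)\<^sup>2 + 2 * (cmod y)\<^sup>2"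
proof -
  have "(cmod (x - y))\<^sup>2 \<le> (cmod x + cmod y)\<^sup>2"
    by (intro power_mono norm_triangle_ineq4) simp
  also have "\<dots> \<le> 2 * (cmod x)\<^sup>2 + 2 * (cmod y)\<^sup>2"
    using sum_squares_bound[of "cmod x" "cmod y"] by (simp add: power2_sum)
  finally show ?thesis .
qed

text \<open>Pointwise convergence supplies the limit, but only the norms are bounded, so dominated
  convergence does not apply directly. The differences are split into a dominated part and a part
  whose integral is small uniformly in \<open>n\<close>.\<close>

lemma weak_L2_convergence:
  fixes f G :: "'a \<Rightarrow> complex" and Gn :: "nat \<Rightarrow> 'a \<Rightarrow> complex"
  assumes f: "f \<in> borel_measurable M" "integrable M (\<lambda>x. (cmod (f x))\<^sup>2)"
    and G: "G \<in> borel_measurable M" "integrable M (\<lambda>x. (cmod (G x))\<^sup>2)"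
    and Gn: "\<And>n. Gn n \<in> borel_measurable M" "\<And>n. integrable M (\<lambda>x. (cmod (Gn n x))\<^sup>2)"
    and bound: "\<And>n. (\<integral>x. (cmod (Gn n x))\<^sup>2 \<partial>M) \<le> K"
    and lim: "\<And>x. (\<lambda>n. Gn n x) \<longlonglongrightarrow> G x"
  shows "(\<lambda>n. \<integral>x. f x * cnj (Gn n x) \<partial>M) \<longlonglongrightarrow> (\<integral>x. f x * cnj (G x) \<partial>M)"
proof -
  note [measurable] = f(1) G(1) Gn(1)
  define d where "d n x = cmod (Gn n x - G x)" for n x
  have d_nonneg: "d n x \<ge> 0" for n x by (simp add: d_def)
  have [measurable]: "d n \<in> borel_measurable M" for n unfolding d_def[abs_def] by measurable
  have d_le: "(d n x)\<^sup>2 \<le> 2 * (cmod (Gn n x))\<^sup>2 + 2 * (cmod (G x))\<^sup>2" for n x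
    unfolding d_def by (rule cmod_diff_sq_le)
  have d_int: "integrable M (\<lambda>x. (d n x)\<^sup>2)" for n
    by (rule Bochner_Integration.integrable_bound[where f="\<lambda>x. 2 * (cmod (Gn n x))\<^sup>2 + 2 * (cmod (G x))\<^sup>2"])
       (use d_le G(2) Gn(2)[of n] in \<open>auto intro!: always_eventually\<close>)
  define L where "L = 2 * K + 2 * (\<integral>x. (cmod (G x))\<^sup>2 \<partial>M)"
  have d_L: "(\<integral>x. (d n x)\<^sup>2 \<partial>M) \<le> L" for n
  proof -
    have "(\<integral>x. (d n x)\<^sup>2 \<partial>M) \<le> (\<integral>x. 2 * (cmod (Gn n x))\<^sup>2 + 2 * (cmod (G x))\<^sup>2 \<partial>M)"
      by (intro integral_mono d_int d_le) (use G(2) Gn(2)[of n] in auto)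
    also have "\<dots> = 2 * (\<integral>x. (cmod (Gn n x))\<^sup>2 \<partial>M) + 2 * (\<integral>x. (cmod (G x))\<^sup>2 \<partial>M)"
      using G(2) Gn(2)[of n] by simp
    finally show ?thesis using bound[of n] by (simp add: L_def)
  qed
  have "L \<ge> 0" using order_trans[OF _ d_L[of 0], of 0] by simp
  have fd: "integrable M (\<lambda>x. cmod (f x) * d n x)" for n
    using integrable_norm[OF integrable_mult_cnj_L2[of f M "\<lambda>x. Gn n x - G x"]] d_int[of n] f
    by (simp add: norm_mult d_def del: complex_cnj_diff)
  have "(\<lambda>n. \<integral>x. cmod (f x) * d n x \<partial>M) \<longlonglongrightarrow> 0"
  proof (rule LIMSEQ_I)
    fix e :: real assume "e > 0"
    \<comment> \<open>This makes \<open>c * L\<close> less than \<open>e / 2\<close>; the summand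
      \<open>1\<close> covers the case \<open>L = 0\<close>.\<close>
    define c where "c = e / (2 * (L + 1))"
    have c: "c > 0" "c * L < e / 2" using \<open>e > 0\<close> \<open>L \<ge> 0\<close> by (simp_all add: c_def field_simps)
    \<comment> \<open>Subtracting \<open>c * (d n x)\<^sup>2\<close>, whose integral is at most \<open>c * L\<close>, leaves a dominated sequence.\<close>
    define k where "k n x = max 0 (cmod (f x) * d n x - c * (d n x)\<^sup>2)" for n x
    have [measurable]: "k n \<in> borel_measurable M" for n unfolding k_def[abs_def] by measurable
    have k_le: "norm (k n x) \<le> (cmod (f x))\<^sup>2 / (4 * c)" for n x
      using linear_le_quadratic[OF c(1), of "cmod (f x)" "d n x"] c by (simp add: k_def)
    have ki: "integrable M (\<lambda>x. (cmod (f x))\<^sup>2 / (4 * c))" using f by simp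
    have "(\<lambda>n. \<integral>x. k n x \<partial>M) \<longlonglongrightarrow> (\<integral>x. 0 \<partial>M)"
    proof (rule integral_dominated_convergence[OF _ _ ki])
      have "(\<lambda>n. k n x) \<longlonglongrightarrow> max 0 (cmod (f x) * 0 - c * 0\<^sup>2)" for x
        unfolding k_def d_def
        by (intro tendsto_intros tendsto_norm_zero LIM_zero lim)
      then show "AE x in M. (\<lambda>n. k n x) \<longlonglongrightarrow> 0" by simp
    qed (use k_le in auto)
    then have "(\<lambda>n. \<integral>x. k n x \<partial>M) \<longlonglongrightarrow> 0" by simp
    from LIMSEQ_D[OF this, of "e / 2"] \<open>e > 0\<close>
    obtain N where N: "\<And>n. n \<ge> N \<Longrightarrow> norm ((\<integral>x. k n x \<partial>M) - 0) < e / 2" by auto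
    have k_int: "integrable M (k n)" for n
      by (rule Bochner_Integration.integrable_bound[OF ki]) (use k_le c in auto)
    show "\<exists>N. \<forall>n\<ge>N. norm ((\<integral>x. cmod (f x) * d n x \<partial>M) - 0) < e"
    proof (intro exI allI impI)
      fix n assume "n \<ge> N"
      have "(\<integral>x. cmod (f x) * d n x \<partial>M) \<le> (\<integral>x. k n x + c * (d n x)\<^sup>2 \<partial>M)"
        using fd k_int d_int by (intro integral_mono) (auto simp: k_def)
      also have "\<dots> = (\<integral>x. k n x \<partial>M) + c * (\<integral>x. (d n x)\<^sup>2 \<partial>M)"
        using k_int d_int by simp
      also have "\<dots> \<le> (\<integral>x. k n x \<partial>M) + c * L"
        using d_L[of n] c by simp
      also have "\<dots> < e" using N[OF \<open>n \<ge> N\<close>] c by simp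
      finally show "norm ((\<integral>x. cmod (f x) * d n x \<partial>M) - 0) < e"
        by (simp add: d_nonneg)
    qed
  qed
  then have "(\<lambda>n. (\<integral>x. f x * cnj (Gn n x) \<partial>M) - (\<integral>x. f x * cnj (G x) \<partial>M)) \<longlonglongrightarrow> 0"
  proof (rule tendsto_0_le[where K=1], intro always_eventually allI)
    fix n
    have i: "integrable M (\<lambda>x. f x * cnj (Gn n x))" "integrable M (\<lambda>x. f x * cnj (G x))"
      using f G Gn[of n] by (auto intro: integrable_mult_cnj_L2)
    have "norm ((\<integral>x. f x * cnj (Gn n x) \<partial>M) - (\<integral>x. f x * cnj (G x) \<partial>M))
        = norm (\<integral>x. f x * cnj (Gn n x) - f x * cnj (G x) \<partial>M)"
      using i by simp
    also have "\<dots> \<le> (\<integral>x. norm (f x * cnj (Gn n x) - f x * cnj (G x)) \<partial>M)"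
      by (rule integral_norm_bound)
    also have "\<dots> = (\<integral>x. cmod (f x) * d n x \<partial>M)"
      unfolding d_def right_diff_distrib[symmetric] complex_cnj_diff[symmetric]
      by (simp only: norm_mult complex_mod_cnj)
    finally show "norm ((\<integral>x. f x * cnj (Gn n x) \<partial>M) - (\<integral>x. f x * cnj (G x) \<partial>M))
      \<le> norm (\<integral>x. cmod (f x) * d n x \<partial>M) * 1" by (simp add: d_nonneg)
  qed
  then show ?thesis by (simp add: LIM_zero_iff)
qed

section \<open>Dilations and the adjoint identity\<close>

lemma fock_inner_tendsto:
  assumes f: "f \<in> fock_space" and G: "G \<in> fock_space" and Gn: "\<And>n. Gn n \<in> fock_space"
    and bound: "\<And>n. (\<integral>z. (cmod (Gn n z))\<^sup>2 * exp (- (cmod z)\<^sup>2) \<partial>lborel) \<le> K"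
    and lim: "\<And>z. (\<lambda>n. Gn n z) \<longlonglongrightarrow> G z"
  shows "(\<lambda>n. fock_inner f (Gn n)) \<longlonglongrightarrow> fock_inner f G"
  unfolding fock_inner_gauss_weight
proof (intro tendsto_mult tendsto_const weak_L2_convergence[where K=K])
  show "gauss_weight f \<in> borel_measurable lborel" "gauss_weight G \<in> borel_measurable lborel"
    "gauss_weight (Gn n) \<in> borel_measurable lborel" for n
    using f G Gn[of n] by (auto intro: gauss_weight_measurable fock_space_borel_measurable)
  show "(\<lambda>n. gauss_weight (Gn n) z) \<longlonglongrightarrow> gauss_weight G z" for z
    unfolding gauss_weight_def by (intro tendsto_intros lim)
qed (use bound in \<open>simp_all add: cmod_gauss_weight_sq fock_space_integrable f G Gn\<close>)

text \<open>
  With \<open>G z = exp (b * z) * g (a * z + a * q)\<close>, the dilation is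
  \<open>exp (b * z) * g (r * (a * z + a * q))\<close>: only the argument of \<open>g\<close> is contracted.
\<close>

definition fock_dilation ::
  "complex \<Rightarrow> complex \<Rightarrow> real \<Rightarrow> (complex \<Rightarrow> complex) \<Rightarrow> complex \<Rightarrow> complex" where
  "fock_dilation b q r G z =
     exp (b * of_real (1 - r) * (z + q)) * G (of_real r * z - of_real (1 - r) * q)"

text \<open>The substitution \<open>w = r z - (1 - r) q\<close> has Jacobian
  \<open>r\<^sup>2\<close>. By convexity its weight leaves a share \<open>1 - r\<close> of
  \<open>(cmod z)\<^sup>2\<close> unspent, which is just enough to absorb the exponential
  prefactor.\<close>

lemma
  assumes G: "G \<in> fock_space" and r: "0 < r" "r \<le> 1"
  shows fock_dilation_in_fock_space: "fock_dilation b q r G \<in> fock_space"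
    and fock_dilation_bound:
      "(\<integral>z. (cmod (fock_dilation b q r G z))\<^sup>2 * exp (- (cmod z)\<^sup>2) \<partial>lborel)
        \<le> exp ((cmod b + cmod q)\<^sup>2) / r\<^sup>2 * (\<integral>z. (cmod (G z))\<^sup>2 * exp (- (cmod z)\<^sup>2) \<partial>lborel)"
proof -
  let ?k = "(cmod b + cmod q)\<^sup>2"
  let ?H = "\<lambda>z. (cmod (G z))\<^sup>2 * exp (- (cmod z)\<^sup>2)"
  let ?w = "\<lambda>z. - (of_real (1 - r) * q) + r *\<^sub>R z"
  have H: "integrable lborel (\<lambda>z. ?H (?w z))"
    "(\<integral>z. ?H (?w z) \<partial>lborel) = (\<integral>z. ?H z \<partial>lborel) / r\<^sup>2"
    using integrable_lborel_affine[OF fock_space_integrable[OF G], of r "- (of_real (1 - r) * q)"]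
      integral_lborel_affine[OF fock_space_integrable[OF G], of r "- (of_real (1 - r) * q)"] r
    by (simp_all add: field_simps)
  have le: "(cmod (fock_dilation b q r G z))\<^sup>2 * exp (- (cmod z)\<^sup>2) \<le> exp ?k * ?H (?w z)" for z
  proof -
    have "cmod (?w z) \<le> cmod (- (of_real (1 - r) * q)) + cmod (r *\<^sub>R z)"
      by (rule norm_triangle_ineq)
    also have "\<dots> = (1 - r) * cmod q + r * cmod z"
      using r by (simp add: norm_mult del: of_real_diff)
    finally have "(cmod (?w z))\<^sup>2 \<le> ((1 - r) * cmod q + r * cmod z)\<^sup>2"
      by (rule power_mono) simp
    \<comment> \<open>Convexity of the square, with its defect written out exactly.\<close>
    also have "\<dots> = (1 - r) * (cmod q)\<^sup>2 + r * (cmod z)\<^sup>2 - r * (1 - r) * (cmod q - cmod z)\<^sup>2"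
      by (simp add: power2_eq_square algebra_simps)
    also have "\<dots> \<le> (1 - r) * (cmod q)\<^sup>2 + r * (cmod z)\<^sup>2"
      using r by simp
    finally have w: "(cmod (?w z))\<^sup>2 \<le> (1 - r) * (cmod q)\<^sup>2 + r * (cmod z)\<^sup>2" .
    have "Re (b * (z + q)) \<le> cmod b * (cmod z + cmod q)"
      using complex_Re_le_cmod[of "b * (z + q)"] mult_left_mono[OF norm_triangle_ineq[of z q], of "cmod b"]
      by (simp add: norm_mult)
    then have "2 * Re (b * (z + q)) \<le> (cmod b)\<^sup>2 + (cmod z)\<^sup>2 + 2 * cmod b * cmod q"
      using sum_squares_bound[of "cmod b" "cmod z"] by (simp add: algebra_simps)
    then have "(1 - r) * (2 * Re (b * (z + q))) \<le> (1 - r) * ((cmod b)\<^sup>2 + (cmod z)\<^sup>2 + 2 * cmod b * cmod q)"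
      using r by (intro mult_left_mono) auto
    with w have "(1 - r) * (2 * Re (b * (z + q))) - (cmod z)\<^sup>2 + (cmod (?w z))\<^sup>2 \<le> (1 - r) * ?k"
      by (simp add: power2_sum algebra_simps)
    also have "\<dots> \<le> ?k" using r by (intro mult_left_le_one_le) auto
    finally have e: "(1 - r) * (2 * Re (b * (z + q))) + - (cmod z)\<^sup>2 \<le> ?k + - (cmod (?w z))\<^sup>2" by simp
    have "cmod (exp (b * of_real (1 - r) * (z + q))) = exp ((1 - r) * Re (b * (z + q)))"
      by (simp add: algebra_simps)
    then have "(cmod (fock_dilation b q r G z))\<^sup>2 * exp (- (cmod z)\<^sup>2)
        = (cmod (G (?w z)))\<^sup>2 * exp ((1 - r) * (2 * Re (b * (z + q))) + - (cmod z)\<^sup>2)"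
      unfolding fock_dilation_def norm_mult exp_add power_mult_distrib
      by (simp add: scaleR_conv_of_real mult_ac flip: exp_double)
    also have "\<dots> \<le> (cmod (G (?w z)))\<^sup>2 * exp (?k + - (cmod (?w z))\<^sup>2)"
      using e by (intro mult_left_mono) auto
    also have "\<dots> = exp ?k * ?H (?w z)" unfolding exp_add by simp
    finally show ?thesis .
  qed
  have hol: "fock_dilation b q r G holomorphic_on UNIV"
    unfolding fock_dilation_def[abs_def]
    by (intro holomorphic_intros holomorphic_on_compose_entire[OF fock_space_holomorphic[OF G]])
  have i: "integrable lborel (\<lambda>z. (cmod (fock_dilation b q r G z))\<^sup>2 * exp (- (cmod z)\<^sup>2))"
  proof (rule Bochner_Integration.integrable_bound)
    show "integrable lborel (\<lambda>z. exp ?k * ?H (?w z))" by (intro integrable_mult_right H)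
    show "(\<lambda>z. (cmod (fock_dilation b q r G z))\<^sup>2 * exp (- (cmod z)\<^sup>2)) \<in> borel_measurable lborel"
      using holomorphic_borel_measurable[OF hol] by measurable
    show "AE z in lborel. norm ((cmod (fock_dilation b q r G z))\<^sup>2 * exp (- (cmod z)\<^sup>2))
        \<le> norm (exp ?k * ?H (?w z))"
      using le by (intro always_eventually allI) simp
  qed
  with hol show "fock_dilation b q r G \<in> fock_space" by (simp add: fock_space_def)
  have "(\<integral>z. (cmod (fock_dilation b q r G z))\<^sup>2 * exp (- (cmod z)\<^sup>2) \<partial>lborel)
      \<le> (\<integral>z. exp ?k * ?H (?w z) \<partial>lborel)"
    by (intro integral_mono i integrable_mult_right H le)
  also have "\<dots> = exp ?k * ((\<integral>z. ?H z \<partial>lborel) / r\<^sup>2)"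
    by (simp only: integral_mult_right_zero H(2))
  finally show "(\<integral>z. (cmod (fock_dilation b q r G z))\<^sup>2 * exp (- (cmod z)\<^sup>2) \<partial>lborel)
        \<le> exp ?k / r\<^sup>2 * (\<integral>z. ?H z \<partial>lborel)" by simp
qed

text \<open>The shift by \<open>2\<close> keeps the radius at least \<open>1 / 2\<close>, so the
  factor \<open>1 / r\<^sup>2\<close> in the norm bound never exceeds \<open>4\<close>.\<close>

definition dilation_radius :: "nat \<Rightarrow> real" where
  "dilation_radius n = 1 - 1 / real (n + 2)"

lemma dilation_radius_bounds: "1 / 2 \<le> dilation_radius n" "dilation_radius n < 1"
  by (auto simp: dilation_radius_def field_simps)

lemma dilation_radius_tendsto: "dilation_radius \<longlonglongrightarrow> 1"
  unfolding dilation_radius_def[abs_def] by real_asymp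

lemma fock_inner_dilation_tendsto:
  assumes f: "f \<in> fock_space" and G: "G \<in> fock_space"
  shows "(\<lambda>n. fock_inner f (fock_dilation b q (dilation_radius n) G)) \<longlonglongrightarrow> fock_inner f G"
proof (rule fock_inner_tendsto[OF f G])
  fix n
  let ?r = "dilation_radius n" and ?I = "\<integral>z. (cmod (G z))\<^sup>2 * exp (- (cmod z)\<^sup>2) \<partial>lborel"
  have r: "0 < ?r" "?r \<le> 1" "1 / 2 \<le> ?r" using dilation_radius_bounds[of n] by auto
  show "fock_dilation b q ?r G \<in> fock_space" by (rule fock_dilation_in_fock_space[OF G r(1,2)])
  have "1 / ?r\<^sup>2 \<le> 1 / (1 / 2)\<^sup>2"
    using r by (intro divide_left_mono power_mono) auto
  then have "exp ((cmod b + cmod q)\<^sup>2) * ?I * (1 / ?r\<^sup>2) \<le> exp ((cmod b + cmod q)\<^sup>2) * ?I * 4"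
    by (intro mult_left_mono) (auto simp: power2_eq_square)
  with fock_dilation_bound[OF G r(1,2), of b q]
  show "(\<integral>z. (cmod (fock_dilation b q ?r G z))\<^sup>2 * exp (- (cmod z)\<^sup>2) \<partial>lborel)
      \<le> exp ((cmod b + cmod q)\<^sup>2) * ?I * 4" by simp
next
  fix z
  have "isCont G z"
    using holomorphic_on_imp_continuous_on[OF fock_space_holomorphic[OF G, of UNIV]]
    by (auto intro: continuous_on_interior)
  moreover have "(\<lambda>n. of_real (dilation_radius n) * z - of_real (1 - dilation_radius n) * q)
      \<longlonglongrightarrow> of_real 1 * z - of_real (1 - 1) * q"
    by (intro tendsto_intros dilation_radius_tendsto)
  ultimately have "(\<lambda>n. G (of_real (dilation_radius n) * z - of_real (1 - dilation_radius n) * q)) \<longlonglongrightarrow> G z"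
    by (intro isCont_tendsto_compose[of z G]) auto
  then have "(\<lambda>n. fock_dilation b q (dilation_radius n) G z) \<longlonglongrightarrow> exp (b * of_real (1 - 1) * (z + q)) * G z"
    unfolding fock_dilation_def by (intro tendsto_intros dilation_radius_tendsto)
  then show "(\<lambda>n. fock_dilation b q (dilation_radius n) G z) \<longlonglongrightarrow> G z" by simp
qed

lemma fock_inner_weighted_comp_isometry:
  assumes f: "f \<in> fock_space" and g: "g \<in> fock_space" and A: "cmod A = 1"
    and F: "(\<lambda>z. C * exp (D * z) * f (A * z + B)) \<in> fock_space" (is "?F \<in> _")
    and G: "(\<lambda>z. cnj C * exp (cnj B * z) * g (cnj A * z + cnj D)) \<in> fock_space" (is "?G \<in> _")
  shows "fock_inner ?F g = fock_inner f ?G"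
proof -
  \<comment> \<open>With this \<open>q\<close> the argument of \<open>g\<close> is
    \<open>cnj A * (z + ?q)\<close>, and the dilation of \<open>?G\<close> multiplies that whole
    argument by \<open>r\<close>.\<close>
  let ?q = "cnj D / cnj A"
  have A0: "A \<noteq> 0" using A by auto
  \<comment> \<open>Both dilations correspond to replacing \<open>A\<close> and \<open>D\<close> by
    \<open>A * r\<close> and \<open>D * r\<close> while keeping \<open>B\<close> and
    \<open>C\<close>, so the contractive case links them.\<close>
  have eq: "fock_inner (fock_dilation 0 0 r ?F) g = fock_inner f (fock_dilation (cnj B) ?q r ?G)"
    if r: "0 < r" "r < 1" for r
  proof -
    have "fock_dilation 0 0 r ?F = (\<lambda>z. C * exp (D * of_real r * z) * f (A * of_real r * z + B))"
      by (simp add: fock_dilation_def fun_eq_iff mult_ac)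
    moreover have "fock_dilation (cnj B) ?q r ?G
        = (\<lambda>z. cnj C * exp (cnj B * z) * g (cnj (A * of_real r) * z + cnj (D * of_real r)))"
    proof
      fix z
      let ?w = "of_real r * z - of_real (1 - r) * ?q"
      have "cnj A * ?w + cnj D = cnj (A * of_real r) * z + cnj (D * of_real r)"
        using A0 by (simp add: field_simps)
      moreover have "exp (cnj B * of_real (1 - r) * (z + ?q)) * exp (cnj B * ?w) = exp (cnj B * z)"
        unfolding exp_add[symmetric] by (rule arg_cong[where f=exp]) (use A0 in \<open>simp add: field_simps\<close>)
      then have "exp (cnj B * of_real (1 - r) * (z + ?q)) * (cnj C * exp (cnj B * ?w) * v)
          = cnj C * exp (cnj B * z) * v" for v
        by (simp only: mult.assoc mult.left_commute[of _ "cnj C"]) (simp only: mult.assoc[symmetric])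
      ultimately show "fock_dilation (cnj B) ?q r ?G z
          = cnj C * exp (cnj B * z) * g (cnj (A * of_real r) * z + cnj (D * of_real r))"
        unfolding fock_dilation_def by (simp only:)
    qed
    ultimately show ?thesis
      using fock_inner_weighted_comp_contraction[OF f g, of "A * of_real r" C "D * of_real r" B] A r
      by (simp add: norm_mult)
  qed
  \<comment> \<open>The limit lemma dilates the second argument; conjugation carries it over to the
    first.\<close>
  have "(\<lambda>n. cnj (fock_inner g (fock_dilation 0 0 (dilation_radius n) ?F))) \<longlonglongrightarrow> cnj (fock_inner g ?F)"
    by (intro tendsto_cnj fock_inner_dilation_tendsto g F)
  then have "(\<lambda>n. fock_inner (fock_dilation 0 0 (dilation_radius n) ?F) g) \<longlonglongrightarrow> fock_inner ?F g"
    by (simp only: cnj_fock_inner)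
  moreover have "fock_inner (fock_dilation 0 0 (dilation_radius n) ?F) g
      = fock_inner f (fock_dilation (cnj B) ?q (dilation_radius n) ?G)" for n
    using dilation_radius_bounds[of n] by (intro eq) auto
  ultimately have "(\<lambda>n. fock_inner f (fock_dilation (cnj B) ?q (dilation_radius n) ?G)) \<longlonglongrightarrow> fock_inner ?F g"
    by simp
  then show ?thesis
    using fock_inner_dilation_tendsto[OF f G] by (rule LIMSEQ_unique)
qed

lemma fock_inner_weighted_comp:
  assumes C: "C \<noteq> 0" and f: "f \<in> fock_space" and g: "g \<in> fock_space"
    and F: "(\<lambda>z. C * exp (D * z) * f (A * z + B)) \<in> fock_space" (is "?F \<in> _")
    and G: "(\<lambda>z. cnj C * exp (cnj B * z) * g (cnj A * z + cnj D)) \<in> fock_space" (is "?G \<in> _")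
  shows "fock_inner ?F g = fock_inner f ?G"
proof (cases "cmod A" "1::real" rule: linorder_cases)
  case less
  then show ?thesis by (rule fock_inner_weighted_comp_contraction[OF f g])
next
  case equal
  then show ?thesis by (rule fock_inner_weighted_comp_isometry[OF f g _ F G])
next
  case greater
  \<comment> \<open>The inverse operator is of the same form, with \<open>1 / A\<close> in place of \<open>A\<close>.\<close>
  then have A: "A \<noteq> 0" by auto
  \<comment> \<open>The exponential cancels the constant left by \<open>exp (D * z)\<close> at the
    point \<open>(z - B) / A\<close>.\<close>
  let ?C = "exp (D * B / A) / C"
  have "(\<lambda>z. ?C * exp (- D / A * z) * ?F (1 / A * z + - B / A)) = f"
  proof
    fix z
    have "A * (1 / A * z + - B / A) + B = z" using A by (simp add: field_simps)
    moreover have "exp (D * B / A) * exp (- D / A * z) * exp (D * (1 / A * z + - B / A)) = 1"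
      unfolding exp_add[symmetric] using A by (simp add: field_simps)
    ultimately show "?C * exp (- D / A * z) * ?F (1 / A * z + - B / A) = f z"
      using C by (simp add: mult_ac)
  qed
  moreover have "(\<lambda>z. cnj ?C * exp (cnj (- B / A) * z) * ?G (cnj (1 / A) * z + cnj (- D / A))) = g"
  proof
    fix z
    have "cnj A * (cnj (1 / A) * z + cnj (- D / A)) + cnj D = z" using A by (simp add: field_simps)
    moreover have "cnj (exp (D * B / A)) * exp (cnj (- B / A) * z) *
        exp (cnj B * (cnj (1 / A) * z + cnj (- D / A))) = 1"
      unfolding exp_cnj exp_add[symmetric] using A by (simp add: field_simps)
    ultimately show "cnj ?C * exp (cnj (- B / A) * z) * ?G (cnj (1 / A) * z + cnj (- D / A)) = g z"
      using C by (simp add: mult_ac)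
  qed
  moreover have "cmod (1 / A) < 1" using greater A by (simp add: norm_divide divide_less_eq)
  \<comment> \<open>The roles are exchanged: \<open>?F\<close> and \<open>?G\<close> are the inputs,
    and the inverse operators return \<open>f\<close> and \<open>g\<close>.\<close>
  note fock_inner_weighted_comp_contraction[OF F G this, of ?C "- D / A" "- B / A"]
  ultimately show ?thesis by (simp only:)
qed

section \<open>Density of polynomials and the adjoint\<close>

lemma fock_inner_self:
  "fock_inner f f = of_real ((\<integral>z. (cmod (f z))\<^sup>2 * exp (- (cmod z)\<^sup>2) \<partial>lborel) / pi)"
proof -
  have "f z * cnj (f z) * of_real (exp (- (cmod z)\<^sup>2)) = of_real ((cmod (f z))\<^sup>2 * exp (- (cmod z)\<^sup>2))" for z
    by (simp add: complex_norm_square[symmetric])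
  then show ?thesis by (simp add: fock_inner_def flip: integral_complex_of_real)
qed

lemma fock_norm_eq:
  "fock_norm f = sqrt ((\<integral>z. (cmod (f z))\<^sup>2 * exp (- (cmod z)\<^sup>2) \<partial>lborel) / pi)"
  by (simp add: fock_norm_def fock_inner_self)

lemma fock_space_diff:
  assumes f: "f \<in> fock_space" and g: "g \<in> fock_space"
  shows "(\<lambda>z. f z - g z) \<in> fock_space"
proof -
  have hol: "(\<lambda>z. f z - g z) holomorphic_on UNIV"
    using f g by (intro holomorphic_intros fock_space_holomorphic)
  have "integrable lborel (\<lambda>z. (cmod (f z - g z))\<^sup>2 * exp (- (cmod z)\<^sup>2))"
  proof (rule Bochner_Integration.integrable_bound)
    show "integrable lborel (\<lambda>z. 2 * ((cmod (f z))\<^sup>2 * exp (- (cmod z)\<^sup>2)) + 2 * ((cmod (g z))\<^sup>2 * exp (- (cmod z)\<^sup>2)))"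
      using f g by (intro Bochner_Integration.integrable_add integrable_mult_right fock_space_integrable)
    show "(\<lambda>z. (cmod (f z - g z))\<^sup>2 * exp (- (cmod z)\<^sup>2)) \<in> borel_measurable lborel"
      using holomorphic_borel_measurable[OF hol] by measurable
    show "AE z in lborel. norm ((cmod (f z - g z))\<^sup>2 * exp (- (cmod z)\<^sup>2))
      \<le> norm (2 * ((cmod (f z))\<^sup>2 * exp (- (cmod z)\<^sup>2)) + 2 * ((cmod (g z))\<^sup>2 * exp (- (cmod z)\<^sup>2)))"
      using cmod_diff_sq_le[of "f _" "g _"]
      by (intro always_eventually allI) (simp flip: distrib_right mult.assoc)
  qed
  with hol show ?thesis by (simp add: fock_space_def)
qed

section \<open>Functions of exponential type\<close>

lemma power_le_fact_exp:
  fixes x :: real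
  assumes "x \<ge> 0"
  shows "x ^ n \<le> fact n * exp x"
proof -
  have "(\<Sum>k\<in>{n}. x ^ k /\<^sub>R fact k) \<le> (\<Sum>k. x ^ k /\<^sub>R fact k)"
    using assms by (intro sum_le_suminf summable_exp_generic) auto
  then show ?thesis by (simp add: exp_def field_simps)
qed

text \<open>Each power is bounded by its term in the exponential series. The factor \<open>1\<close>
  in the exponent matches the general shape \<open>k * cmod u\<close>.\<close>

lemma polynomial_exponential_type:
  fixes c :: "nat \<Rightarrow> complex"
  shows "cmod (\<Sum>k<N. c k * u ^ k) \<le> (\<Sum>k<N. cmod (c k) * fact k) * exp (1 * cmod u)"
proof -
  have "cmod (\<Sum>k<N. c k * u ^ k) \<le> (\<Sum>k<N. cmod (c k) * (fact k * exp (cmod u)))"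
    by (intro sum_norm_le) (simp add: norm_mult norm_power mult_left_mono power_le_fact_exp)
  then show ?thesis by (simp add: sum_distrib_right mult.assoc)
qed

text \<open>Exponential type survives affine substitution and multiplication by
  \<open>exp (D * z)\<close>. This puts both the polynomials and the kernels into the domain of the
  operator.\<close>

lemma weighted_comp_exponential_type:
  assumes f: "f holomorphic_on UNIV" and M: "M \<ge> 0" and k: "k \<ge> 0"
    and le: "\<And>u. cmod (f u) \<le> M * exp (k * cmod u)"
  shows "(\<lambda>z. C * exp (D * z) * f (A * z + B)) \<in> fock_space"
proof (rule fock_spaceI_exponential_type[where M="cmod C * M * exp (k * cmod B)" and k="cmod D + k * cmod A"])
  show "(\<lambda>z. C * exp (D * z) * f (A * z + B)) holomorphic_on UNIV"
    by (intro holomorphic_intros holomorphic_on_compose_entire[OF f])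
  show "cmod C * M * exp (k * cmod B) \<ge> 0" using M by simp
  fix z
  have "cmod (f (A * z + B)) \<le> M * exp (k * cmod (A * z + B))" by (rule le)
  also have "\<dots> \<le> M * exp (k * (cmod A * cmod z + cmod B))"
    using M k norm_triangle_ineq[of "A * z" B] by (intro mult_left_mono) (auto simp: norm_mult mult_left_mono)
  finally have "cmod C * cmod (exp (D * z)) * cmod (f (A * z + B))
    \<le> cmod C * exp (cmod (D * z)) * (M * exp (k * (cmod A * cmod z + cmod B)))"
    by (intro mult_mono cmod_exp_le) auto
  also have "\<dots> = cmod C * M * (exp (cmod D * cmod z) * exp (k * (cmod A * cmod z + cmod B)))"
    by (simp add: norm_mult)
  also have "\<dots> = cmod C * M * (exp (k * cmod B) * exp ((cmod D + k * cmod A) * cmod z))"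
    unfolding exp_add[symmetric] by (simp add: algebra_simps)
  finally show "cmod (C * exp (D * z) * f (A * z + B))
      \<le> cmod C * M * exp (k * cmod B) * exp ((cmod D + k * cmod A) * cmod z)"
    by (simp add: norm_mult)
qed

text \<open>Weak convergence becomes norm convergence because the norms are controlled: in the
  expansion of the squared distance, the bounds tend to \<open>I + I - 2 * I = 0\<close>.\<close>

lemma fock_dilation_approx:
  assumes f: "f \<in> fock_space" and e: "e > 0"
  obtains r where "0 < r" "r < 1"
    "(\<integral>z. (cmod (f z - f (of_real r * z)))\<^sup>2 * exp (- (cmod z)\<^sup>2) \<partial>lborel) < e"
proof -
  let ?E = "\<lambda>z::complex. exp (- (cmod z)\<^sup>2)" and ?r = dilation_radius
  let ?f = "\<lambda>n. fock_dilation 0 0 (?r n) f"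
  define I where "I = (\<integral>z. (cmod (f z))\<^sup>2 * ?E z \<partial>lborel)"
  have r: "0 < ?r n" "?r n < 1" "?r n \<le> 1" for n using dilation_radius_bounds[of n] by auto
  have fn: "?f n \<in> fock_space" for n using f r by (intro fock_dilation_in_fock_space)
  have le: "(\<integral>z. (cmod (f z - ?f n z))\<^sup>2 * ?E z \<partial>lborel) \<le> I + I / (?r n)\<^sup>2 - 2 * (pi * Re (fock_inner f (?f n)))" for n
  proof -
    let ?c = "\<lambda>z. f z * cnj (?f n z) * of_real (?E z)"
    have "(cmod (f z - ?f n z))\<^sup>2 * ?E z
        = (cmod (f z))\<^sup>2 * ?E z + (cmod (?f n z))\<^sup>2 * ?E z - 2 * Re (?c z)" for z
      unfolding cmod_power2 by (simp add: power2_eq_square algebra_simps)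
    moreover have c: "integrable lborel ?c" by (rule integrable_fock_inner[OF f fn])
    moreover have "(\<integral>z. Re (?c z) \<partial>lborel) = pi * Re (fock_inner f (?f n))"
      unfolding fock_inner_def integral_Re[OF c] by simp
    ultimately have "(\<integral>z. (cmod (f z - ?f n z))\<^sup>2 * ?E z \<partial>lborel)
        = I + (\<integral>z. (cmod (?f n z))\<^sup>2 * ?E z \<partial>lborel) - 2 * (pi * Re (fock_inner f (?f n)))"
      using fock_space_integrable[OF f] fock_space_integrable[OF fn[of n]] integrable_Re[OF c] by (simp add: I_def)
    then show ?thesis
      \<comment> \<open>For \<open>b = q = 0\<close> the exponential constant is \<open>1\<close>,
        which leaves \<open>I\<close> divided by the square of the radius.\<close>
      using fock_dilation_bound[OF f r(1,3)[of n], of 0 0] by (simp add: I_def)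
  qed
  have "(\<lambda>n. I + I / (?r n)\<^sup>2 - 2 * (pi * Re (fock_inner f (?f n))))
      \<longlonglongrightarrow> I + I / 1\<^sup>2 - 2 * (pi * Re (fock_inner f f))"
    by (intro tendsto_intros dilation_radius_tendsto fock_inner_dilation_tendsto[OF f f]) auto
  also have "I + I / 1\<^sup>2 - 2 * (pi * Re (fock_inner f f)) = 0"
    by (simp add: fock_inner_self I_def)
  finally have "\<forall>\<^sub>F n in sequentially. I + I / (?r n)\<^sup>2 - 2 * (pi * Re (fock_inner f (?f n))) < e"
    using e by (rule order_tendstoD(2))
  then obtain n where "I + I / (?r n)\<^sup>2 - 2 * (pi * Re (fock_inner f (?f n))) < e"
    by (auto simp: eventually_sequentially)
  with le[of n] have "(\<integral>z. (cmod (f z - ?f n z))\<^sup>2 * ?E z \<partial>lborel) < e" by simp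
  with r[of n] that[of "?r n"] show ?thesis by (simp add: fock_dilation_def)
qed

text \<open>Dilation makes the growth rate strictly smaller than \<open>1 / 2\<close>. This leaves
  room to bound all Taylor polynomials by one square integrable function, so their pointwise
  convergence is dominated.\<close>

lemma fock_taylor_approx:
  assumes f: "f \<in> fock_space" and r: "0 < r" "r < 1" and e: "e > 0"
  obtains c :: "nat \<Rightarrow> complex" and N where
    "(\<integral>z. (cmod (f (of_real r * z) - (\<Sum>k<N. c k * z ^ k)))\<^sup>2 * exp (- (cmod z)\<^sup>2) \<partial>lborel) < e"
proof -
  let ?E = "\<lambda>z::complex. exp (- (cmod z)\<^sup>2)"
  obtain M where M: "M \<ge> 0" "\<And>u. cmod (f u) \<le> M * exp ((cmod u)\<^sup>2 / 2)"
    by (rule fock_space_pointwise_bound[OF f]) blast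
  define a where "a k = (deriv ^^ k) f 0 / fact k" for k
  \<comment> \<open>Cauchy's inequality on the circle of radius \<open>R\<close>, with the pointwise
    bound for \<open>f\<close>; a vanishing radius only concerns \<open>k = 0\<close>.\<close>
  have a: "cmod (a k) * R ^ k \<le> M * exp (R\<^sup>2 / 2)" if "R \<ge> 0" for k R
  proof (cases "R = 0")
    case True
    then show ?thesis using M(2)[of 0] M(1) by (cases k) (auto simp: a_def)
  next
    case False
    have "cmod ((deriv ^^ k) f 0) \<le> fact k * (M * exp (R\<^sup>2 / 2)) / R ^ k"
    proof (rule Cauchy_inequality)
      show "cmod (f x) \<le> M * exp (R\<^sup>2 / 2)" if "cmod (0 - x) = R" for x
        using M(2)[of x] that by simp
    qed (use False \<open>R \<ge> 0\<close> f in \<open>auto intro: fock_space_holomorphic holomorphic_on_imp_continuous_on\<close>)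
    then show ?thesis
      using False \<open>R \<ge> 0\<close> by (simp add: a_def norm_divide field_simps)
  qed
  \<comment> \<open>A radius strictly between \<open>r\<close> and \<open>1\<close>: using radius
    \<open>s * cmod z\<close> in the coefficient bound yields the summable factor
    \<open>(r / s) ^ k\<close>, while \<open>s\<^sup>2 < 1\<close> keeps Gaussian decay.\<close>
  define s where "s = (1 + r) / 2"
  have s: "0 < s" "s < 1" "r < s" using r by (auto simp: s_def)
  define p where "p N z = (\<Sum>k<N. a k * of_real r ^ k * z ^ k)" for N z
  define T where "T z = M * exp (s\<^sup>2 * (cmod z)\<^sup>2 / 2) * (1 / (1 - r / s))" for z
  have p_le: "cmod (p N z) \<le> T z" for N z
  proof -
    have "cmod (p N z) \<le> (\<Sum>k<N. M * exp (s\<^sup>2 * (cmod z)\<^sup>2 / 2) * (r / s) ^ k)"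
      unfolding p_def
    proof (rule sum_norm_le)
      fix k
      have "cmod (a k) * (s * cmod z) ^ k * (r / s) ^ k \<le> M * exp ((s * cmod z)\<^sup>2 / 2) * (r / s) ^ k"
        using s r by (intro mult_right_mono a) auto
      moreover have "cmod (a k * of_real r ^ k * z ^ k) = cmod (a k) * (s * cmod z) ^ k * (r / s) ^ k"
        using s r by (simp add: norm_mult norm_power power_mult_distrib power_divide)
      ultimately show "cmod (a k * of_real r ^ k * z ^ k) \<le> M * exp (s\<^sup>2 * (cmod z)\<^sup>2 / 2) * (r / s) ^ k"
        by (simp add: power_mult_distrib)
    qed
    also have "\<dots> = M * exp (s\<^sup>2 * (cmod z)\<^sup>2 / 2) * (\<Sum>k<N. (r / s) ^ k)"
      by (simp add: sum_distrib_left)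
    also have "\<dots> \<le> T z"
      unfolding T_def
    proof (rule mult_left_mono)
      have "(\<Sum>k<N. (r / s) ^ k) \<le> (\<Sum>k. (r / s) ^ k)"
        using s r by (intro sum_le_suminf summable_geometric) auto
      also have "\<dots> = 1 / (1 - r / s)"
        using s r by (intro suminf_geometric) auto
      finally show "(\<Sum>k<N. (r / s) ^ k) \<le> 1 / (1 - r / s)" .
    qed (use M in simp)
    finally show ?thesis .
  qed
  have lim: "(\<lambda>N. p N z) \<longlonglongrightarrow> f (of_real r * z)" for z
  proof -
    have "(\<lambda>k. a k * (of_real r * z - 0) ^ k) sums f (of_real r * z)"
      unfolding a_def
      by (rule holomorphic_power_series[where r="cmod (of_real r * z) + 1"]) (auto intro: fock_space_holomorphic[OF f])
    then show ?thesis by (simp add: sums_def p_def power_mult_distrib mult.assoc)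
  qed
  have f_le: "cmod (f (of_real r * z)) \<le> T z" for z
    by (rule LIMSEQ_le_const2[OF tendsto_norm[OF lim]]) (use p_le in auto)
  have d_le: "(cmod (f (of_real r * z) - p N z))\<^sup>2 * ?E z
      \<le> (2 * (M * (1 / (1 - r / s))))\<^sup>2 * exp (- ((1 - s\<^sup>2) * (cmod z)\<^sup>2))" for N z
  proof -
    have "cmod (f (of_real r * z) - p N z) \<le> 2 * T z"
      using norm_triangle_ineq4[of "f (of_real r * z)" "p N z"] f_le[of z] p_le[of N z] by linarith
    then have "(cmod (f (of_real r * z) - p N z))\<^sup>2 * ?E z \<le> (2 * T z)\<^sup>2 * ?E z"
      by (intro mult_right_mono power_mono) auto
    also have "(2 * T z)\<^sup>2 * ?E z
      = (2 * (M * (1 / (1 - r / s))))\<^sup>2 * ((exp (s\<^sup>2 * (cmod z)\<^sup>2 / 2))\<^sup>2 * ?E z)"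
      unfolding T_def power_mult_distrib by (simp add: mult_ac)
    also have "(exp (s\<^sup>2 * (cmod z)\<^sup>2 / 2))\<^sup>2 * ?E z = exp (- ((1 - s\<^sup>2) * (cmod z)\<^sup>2))"
      unfolding exp_double[symmetric] exp_add[symmetric] by (simp add: algebra_simps)
    finally show ?thesis .
  qed
  have "s\<^sup>2 < 1" using s by (simp add: power_less_one_iff)
  then have Ti: "integrable lborel (\<lambda>z::complex. (2 * (M * (1 / (1 - r / s))))\<^sup>2 * exp (- ((1 - s\<^sup>2) * (cmod z)\<^sup>2)))"
    by (intro integrable_mult_right integrable_gaussian) simp
  have [measurable]: "(\<lambda>z. f (of_real r * z)) \<in> borel_measurable borel" "p N \<in> borel_measurable borel" for N
    unfolding p_def[abs_def]
    by (intro holomorphic_borel_measurable holomorphic_intros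
        holomorphic_on_compose_entire[OF fock_space_holomorphic[OF f]])+
  have "(\<lambda>N. \<integral>z. (cmod (f (of_real r * z) - p N z))\<^sup>2 * ?E z \<partial>lborel) \<longlonglongrightarrow> integral\<^sup>L lborel (\<lambda>z::complex. 0)"
  proof (rule integral_dominated_convergence[OF _ _ Ti])
    have "(\<lambda>N. (cmod (f (of_real r * z) - p N z))\<^sup>2 * ?E z)
        \<longlonglongrightarrow> (cmod (f (of_real r * z) - f (of_real r * z)))\<^sup>2 * ?E z" for z
      by (intro tendsto_intros lim)
    then show "AE z in lborel. (\<lambda>N. (cmod (f (of_real r * z) - p N z))\<^sup>2 * ?E z) \<longlonglongrightarrow> 0"
      by simp
  qed (use d_le in auto)
  then have "(\<lambda>N. \<integral>z. (cmod (f (of_real r * z) - p N z))\<^sup>2 * ?E z \<partial>lborel) \<longlonglongrightarrow> 0"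
    by simp
  then have "\<forall>\<^sub>F N in sequentially. (\<integral>z. (cmod (f (of_real r * z) - p N z))\<^sup>2 * ?E z \<partial>lborel) < e"
    using e by (rule order_tendstoD(2))
  then obtain N where "(\<integral>z. (cmod (f (of_real r * z) - p N z))\<^sup>2 * ?E z \<partial>lborel) < e"
    by (auto simp: eventually_sequentially)
  then show ?thesis unfolding p_def by (rule that)
qed

lemma polynomials_dense_fock_space:
  assumes f: "f \<in> fock_space" and e: "e > 0"
  obtains c :: "nat \<Rightarrow> complex" and N where "fock_norm (\<lambda>z. f z - (\<Sum>k<N. c k * z ^ k)) < e"
proof -
  let ?E = "\<lambda>z::complex. exp (- (cmod z)\<^sup>2)"
  \<comment> \<open>Splitting the squared norm costs a factor \<open>2\<close> on each of two
    errors, and \<open>fock_norm\<close> divides by \<open>pi\<close>; together they stay below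
    \<open>4 * d = e\<^sup>2 * pi\<close>.\<close>
  define d where "d = e\<^sup>2 * pi / 4"
  have d: "d > 0" using e by (simp add: d_def)
  obtain r where r: "0 < r" "r < 1"
    and 1: "(\<integral>z. (cmod (f z - f (of_real r * z)))\<^sup>2 * ?E z \<partial>lborel) < d"
    by (rule fock_dilation_approx[OF f d])
  obtain c :: "nat \<Rightarrow> complex" and N where
    2: "(\<integral>z. (cmod (f (of_real r * z) - (\<Sum>k<N. c k * z ^ k)))\<^sup>2 * ?E z \<partial>lborel) < d"
    by (rule fock_taylor_approx[OF f r d])
  let ?p = "\<lambda>z. \<Sum>k<N. c k * z ^ k" and ?f = "\<lambda>z. f (of_real r * z)"
  have p: "?p \<in> fock_space"
    by (rule fock_spaceI_exponential_type[OF _ _ polynomial_exponential_type]) (auto intro!: holomorphic_intros sum_nonneg)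
  have fr: "?f \<in> fock_space"
    using fock_dilation_in_fock_space[OF f, of r 0 0] r by (simp add: fock_dilation_def[abs_def])
  note i = fock_space_integrable[OF fock_space_diff[OF f fr]] fock_space_integrable[OF fock_space_diff[OF fr p]]
  have "(\<integral>z. (cmod (f z - ?p z))\<^sup>2 * ?E z \<partial>lborel)
    \<le> (\<integral>z. 2 * ((cmod (f z - ?f z))\<^sup>2 * ?E z) + 2 * ((cmod (?f z - ?p z))\<^sup>2 * ?E z) \<partial>lborel)"
  proof (rule integral_mono)
    show "integrable lborel (\<lambda>z. (cmod (f z - ?p z))\<^sup>2 * ?E z)"
      by (rule fock_space_integrable[OF fock_space_diff[OF f p]])
    show "integrable lborel (\<lambda>z. 2 * ((cmod (f z - ?f z))\<^sup>2 * ?E z) + 2 * ((cmod (?f z - ?p z))\<^sup>2 * ?E z))"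
      by (intro Bochner_Integration.integrable_add integrable_mult_right i)
    fix z
    have "(cmod (f z - ?p z))\<^sup>2 * ?E z \<le> (2 * (cmod (f z - ?f z))\<^sup>2 + 2 * (cmod (?p z - ?f z))\<^sup>2) * ?E z"
      using cmod_diff_sq_le[of "f z - ?f z" "?p z - ?f z"] by (intro mult_right_mono) auto
    then show "(cmod (f z - ?p z))\<^sup>2 * ?E z \<le> 2 * ((cmod (f z - ?f z))\<^sup>2 * ?E z) + 2 * ((cmod (?f z - ?p z))\<^sup>2 * ?E z)"
      by (simp add: algebra_simps norm_minus_commute[of "?p z"])
  qed
  also have "\<dots> = 2 * (\<integral>z. (cmod (f z - ?f z))\<^sup>2 * ?E z \<partial>lborel) + 2 * (\<integral>z. (cmod (?f z - ?p z))\<^sup>2 * ?E z \<partial>lborel)"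
    using i by simp
  also have "\<dots> < 4 * d" using 1 2 by linarith
  also have "4 * d = e\<^sup>2 * pi" by (simp add: d_def)
  finally have "(\<integral>z. (cmod (f z - ?p z))\<^sup>2 * ?E z \<partial>lborel) / pi < e\<^sup>2"
    by (simp add: divide_less_eq)
  then have "fock_norm (\<lambda>z. f z - ?p z) < e"
    unfolding fock_norm_eq using e by (simp add: real_less_lsqrt)
  then show ?thesis by (rule that)
qed

theorem theorem3p7:
  fixes A B C D :: complex
    and \<psi> \<phi> \<psi>h \<phi>h :: "complex \<Rightarrow> complex"
  assumes "C \<noteq> 0"
    and "\<And>z. \<psi> z = C * exp (D * z)"
    and "\<And>z. \<phi> z = A * z + B"
    and "\<And>z. \<psi>h z = cnj C * exp (cnj B * z)"
    and "\<And>z. \<phi>h z = cnj A * z + cnj D"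
  shows "densely_defined (weighted_comp_max \<psi> \<phi>) \<and>
         fock_adjoint (weighted_comp_max \<psi> \<phi>) = weighted_comp_max \<psi>h \<phi>h"
proof
  let ?T = "weighted_comp_max \<psi> \<phi>"
  have W: "weighted_comp \<psi> \<phi> f = (\<lambda>z. C * exp (D * z) * f (A * z + B))"
    and Wh: "weighted_comp \<psi>h \<phi>h f = (\<lambda>z. cnj C * exp (cnj B * z) * f (cnj A * z + cnj D))" for f
    by (simp_all add: weighted_comp_def assms)
  have dom: "f \<in> dom ?T \<longleftrightarrow> f \<in> fock_space \<and> weighted_comp \<psi> \<phi> f \<in> fock_space" for f
    by (auto simp: weighted_comp_max_def dom_def)
  have domI: "f \<in> dom ?T" if "f holomorphic_on UNIV" "M \<ge> 0" "k \<ge> 0"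
    "\<And>u. cmod (f u) \<le> M * exp (k * cmod u)" for f M k
    unfolding dom W using that
    by (auto intro: fock_spaceI_exponential_type weighted_comp_exponential_type)
  show "densely_defined ?T"
    unfolding densely_defined_def
  proof (intro conjI ballI allI impI)
    show "dom ?T \<subseteq> fock_space" using dom by auto
    fix f :: "complex \<Rightarrow> complex" and e :: real
    assume "f \<in> fock_space" "e > 0"
    then obtain c :: "nat \<Rightarrow> complex" and N where "fock_norm (\<lambda>z. f z - (\<Sum>k<N. c k * z ^ k)) < e"
      by (rule polynomials_dense_fock_space)
    moreover have "(\<lambda>z. \<Sum>k<N. c k * z ^ k) \<in> dom ?T"
      by (rule domI[OF _ _ _ polynomial_exponential_type]) (auto intro!: holomorphic_intros sum_nonneg)
    ultimately show "\<exists>g\<in>dom ?T. fock_norm (\<lambda>z. f z - g z) < e" by (rule bexI)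
  qed
  \<comment> \<open>This yields both the uniqueness behind \<open>THE\<close> and the inclusion of
    the adjoint in the hatted operator.\<close>
  have unique: "h = weighted_comp \<psi>h \<phi>h g" if "adjoint_pair ?T g h" for g h
  proof
    fix w
    have g: "g \<in> fock_space" and h: "h \<in> fock_space"
      and eq: "\<And>f. f \<in> dom ?T \<Longrightarrow> fock_inner (the (?T f)) g = fock_inner f h"
      using that by (auto simp: adjoint_pair_def)
    \<comment> \<open>The operator sends the kernel at \<open>w\<close> to a multiple of the kernel
      at \<open>v\<close>; pairing with \<open>g\<close> therefore evaluates \<open>g\<close> at
      \<open>v\<close>.\<close>
    define v where "v = cnj A * w + cnj D"
    let ?K = "\<lambda>u z. exp (cnj u * z)"
    have K: "?K w \<in> dom ?T"
      using cmod_exp_le[of "cnj w * _"]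
      by (intro domI[where M=1 and k="cmod w"]) (auto simp: norm_mult intro!: holomorphic_intros)
    then have "the (?T (?K w)) = weighted_comp \<psi> \<phi> (?K w)"
      using dom by (simp add: weighted_comp_max_def)
    also have "\<dots> = (\<lambda>z. C * exp (cnj w * B) * ?K v z)"
      unfolding W mult.assoc exp_add[symmetric] by (simp add: v_def algebra_simps)
    finally have "fock_inner (\<lambda>z. C * exp (cnj w * B) * ?K v z) g = fock_inner (?K w) h"
      using eq[OF K] by simp
    moreover have "fock_inner (\<lambda>z. C * exp (cnj w * B) * ?K v z) g = C * exp (cnj w * B) * fock_inner (?K v) g"
      unfolding fock_inner_def mult.assoc by simp
    ultimately have "C * exp (cnj w * B) * cnj (g v) = cnj (h w)"
      by (simp add: cnj_fock_inner[of _ "?K _", symmetric] fock_inner_kernel[OF g] fock_inner_kernel[OF h])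
    then have "h w = cnj (C * exp (cnj w * B) * cnj (g v))" by simp
    then show "h w = weighted_comp \<psi>h \<phi>h g w" by (simp add: Wh v_def exp_cnj mult_ac)
  qed
  show "fock_adjoint ?T = weighted_comp_max \<psi>h \<phi>h"
  proof
    fix g
    show "fock_adjoint ?T g = weighted_comp_max \<psi>h \<phi>h g"
    proof (cases "g \<in> fock_space \<and> weighted_comp \<psi>h \<phi>h g \<in> fock_space")
      case True
      then have "adjoint_pair ?T g (weighted_comp \<psi>h \<phi>h g)"
        using fock_inner_weighted_comp[OF \<open>C \<noteq> 0\<close>, of _ g D A B] dom
        by (auto simp: adjoint_pair_def weighted_comp_max_def W Wh)
      with unique have "(THE h. adjoint_pair ?T g h) = weighted_comp \<psi>h \<phi>h g" "\<exists>h. adjoint_pair ?T g h"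
        by (blast intro: the_equality)+
      with True show ?thesis by (simp add: fock_adjoint_def weighted_comp_max_def)
    next
      case False
      \<comment> \<open>A partner \<open>h\<close> would lie in the Fock space together with
        \<open>g\<close> and equal the hatted image of \<open>g\<close>, placing \<open>g\<close> in
        the excluded domain.\<close>
      have "\<not> adjoint_pair ?T g h" for h
        using unique[of g h] False by (auto simp: adjoint_pair_def)
      with False show ?thesis by (auto simp: fock_adjoint_def weighted_comp_max_def)
    qed
  qed
qed

end
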